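(* Let $(A;\{E_i\}_{i=0}^d;A^*;\{E^*_i\}_{i=0}^d)$ be a Leonard system in $\mathcal{A}$ and let $S$ denote the corresponding switching element. Then for all nonzero $X\in\mathcal{A}$ the following (i), (ii) are equivalent. (i) $X$ is a scalar multiple of $S$. (ii) $X[0^*0]\subseteq[D^*0]$ and $X[0^*D]\subseteq[D^*D]$. Suppose (i), (ii) hold. Then equality holds everywhere in (ii).
   Context: $\mathbb{K}$ is a field, $d\ge 0$ an integer, $\mathcal{A}$ a $\mathbb{K}$-algebra isomorphic to $\mathrm{Mat}_{d+1}(\mathbb{K})$, $I$ its identity, and $V$ a simple left $\mathcal{A}$-module (so $\dim V=d+1$). The symbol $A^*$ is just a name for a second element (not a conjugate transpose). An element $A\in\mathcal{A}$ is multiplicity-free if it has $d+1$ mutually distinct eigenvalues in $\mathbb{K}$. For an ordering $\{\theta_i\}_{i=0}^d$ of these eigenvalues, the primitive idempotent of $A$ associated with $\theta_i$ is $E_i=\prod_{0\le j\le d,\,j\ne i}\frac{A-\theta_jI}{\theta_i-\theta_j}$. A Leonard system in $\mathcal{A}$ is a sequence $\Phi=(A;\{E_i\}_{i=0}^d;A^*;\{E^*_i\}_{i=0}^d)$ such that $A,A^*\in\mathcal{A}$ are multiplicity-free; $\{E_i\}_{i=0}^d$ (resp. $\{E^*_i\}_{i=0}^d$) is an ordering of the primitive idempotents of $A$ (resp. $A^*$); and for $0\le i,j\le d$ both $E_iA^*E_j$ and $E^*_iAE^*_j$ are zero if $|i-j|>1$ and nonzero if $|i-j|=1$. Let $\theta_i$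 (resp. $\theta^*_i$) be the eigenvalue of $A$ (resp. $A^*$) associated with $E_i$ (resp. $E^*_i$). Put $\tau_i=(\lambda-\theta_0)(\lambda-\theta_1)\cdots(\lambda-\theta_{i-1})$ and $\eta_i=(\lambda-\theta_d)(\lambda-\theta_{d-1})\cdots(\lambda-\theta_{d-i+1})$ for $0\le i\le d$. The first and second split sequences of $\Phi$ are, for $1\le i\le d$, $\varphi_i=(\theta^*_0-\theta^*_i)\frac{\mathrm{tr}(\tau_i(A)E^*_0)}{\mathrm{tr}(\tau_{i-1}(A)E^*_0)}$ and $\phi_i=(\theta^*_0-\theta^*_i)\frac{\mathrm{tr}(\eta_i(A)E^*_0)}{\mathrm{tr}(\eta_{i-1}(A)E^*_0)}$ (the denominators are known to be nonzero, and all $\varphi_i,\phi_i$ are known to be nonzero). The switching element for $\Phi$ is $S=\sum_{r=0}^d\frac{\phi_d\phi_{d-1}\cdots\phi_{d-r+1}}{\varphi_1\varphi_2\cdots\varphi_r}E_r$. Flags: $[0],[D],[0^*],[D^*]$ are the sequences of subspaces of $V$, indexed by $0\le i\le d$, whose $i$th components are respectively $E_0V+\cdots+E_iV$; $E_dV+E_{d-1}V+\cdots+E_{d-i}V$; $E^*_0V+\cdots+E^*_iV$; $E^*_dV+E^*_{d-1}V+\cdots+E^*_{d-i}V$. These are known to be mutually opposite. For distinct $z,w\in\{0,D,0^*,D^*\}$, $[zw]$ denotes the induced decomposition of $V$, i.e. the sequence of one-dimensional subspaces with direct sum $V$ whose $i$th component ($0\le i\le d$) is the intersection of the $i$th component of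 $[z]$ and the $(d-i)$th component of $[w]$. For a sequence $F=\{F_i\}_{i=0}^d$ of subspaces of $V$ and $X\in\mathcal{A}$, $XF$ denotes $\{XF_i\}_{i=0}^d$; for two such sequences, $F\subseteq F'$ means $F_i\subseteq F'_i$ for $0\le i\le d$. *)

theory Defs
  imports
    "Jordan_Normal_Form.Char_Poly"
    "HOL-Library.Set_Algebras"
begin

text \<open>
  The algebra is a type \<open>'a::ring_1\<close> with scalar multiplication \<open>smul\<close> over the field \<open>'k\<close>,
  together with an explicit isomorphism \<open>f\<close> onto the \<open>(d+1) \<times> (d+1)\<close> matrices. Eigenvalues
  and traces of elements are read off through \<open>f\<close>; any two such isomorphisms differ by a
  conjugation, so the choice of \<open>f\<close> does not matter.

  All finite sequences indexed by \<open>0,...,d\<close> are functions on \<open>nat\<close>, of which only the values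
  at indices \<open>\<le> d\<close> are meaningful.
\<close>

locale algebra_over_field = vector_space smul
  for smul :: "'k::field \<Rightarrow> 'a::ring_1 \<Rightarrow> 'a" +
  assumes smul_mult_left: "smul c x * y = smul c (x * y)"
    and smul_mult_right: "x * smul c y = smul c (x * y)"

locale full_matrix_algebra = algebra_over_field smul
  for smul :: "'k::field \<Rightarrow> 'a::ring_1 \<Rightarrow> 'a" +
  fixes d :: nat
    and f :: "'a \<Rightarrow> 'k mat"
  assumes iso_bij: "bij_betw f UNIV (carrier_mat (d + 1) (d + 1))"
    and iso_add: "f (x + y) = f x + f y"
    and iso_mult: "f (x * y) = f x * f y"
    and iso_one: "f 1 = 1\<^sub>m (d + 1)"
    and iso_smul: "f (smul c x) = c \<cdot>\<^sub>m f x"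

text \<open>
  The induced \<open>'k\<close>-vector space structure on a left module is \<open>c v = act (smul c 1) v\<close>.
\<close>

locale left_module =
  fixes act :: "'a::ring_1 \<Rightarrow> 'v::ab_group_add \<Rightarrow> 'v"
  assumes act_add_right: "act x (v + w) = act x v + act x w"
    and act_add_left: "act (x + y) v = act x v + act y v"
    and act_mult: "act (x * y) v = act x (act y v)"
    and act_one: "act 1 v = v"

definition submodule_of :: "('a::ring_1 \<Rightarrow> 'v::ab_group_add \<Rightarrow> 'v) \<Rightarrow> 'v set \<Rightarrow> bool" where
  "submodule_of act W \<longleftrightarrow>
     0 \<in> W \<and> (\<forall>v\<in>W. \<forall>w\<in>W. v + w \<in> W) \<and> (\<forall>x. \<forall>v\<in>W. act x v \<in> W)"

locale simple_left_module = left_module act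
  for act :: "'a::ring_1 \<Rightarrow> 'v::ab_group_add \<Rightarrow> 'v" +
  assumes nonzero: "\<exists>v::'v. v \<noteq> 0"
    and simple: "submodule_of act W \<Longrightarrow> W = {0} \<or> W = UNIV"

definition alg_trace :: "nat \<Rightarrow> ('a \<Rightarrow> 'k::field mat) \<Rightarrow> 'a \<Rightarrow> 'k" where
  "alg_trace d f X = (\<Sum>i<d + 1. f X $$ (i, i))"

definition eigenvalues_of :: "('a \<Rightarrow> 'k::field mat) \<Rightarrow> 'a \<Rightarrow> 'k set" where
  "eigenvalues_of f A = {t. eigenvalue (f A) t}"

definition multiplicity_free :: "nat \<Rightarrow> ('a \<Rightarrow> 'k::field mat) \<Rightarrow> 'a \<Rightarrow> bool" where
  "multiplicity_free d f A \<longleftrightarrow> card (eigenvalues_of f A) = d + 1"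

definition eigenvalue_ordering ::
  "nat \<Rightarrow> ('a \<Rightarrow> 'k::field mat) \<Rightarrow> 'a \<Rightarrow> (nat \<Rightarrow> 'k) \<Rightarrow> bool" where
  "eigenvalue_ordering d f A \<theta> \<longleftrightarrow> bij_betw \<theta> {0..d} (eigenvalues_of f A)"

definition primitive_idempotent ::
  "('k::field \<Rightarrow> 'a::ring_1 \<Rightarrow> 'a) \<Rightarrow> nat \<Rightarrow> 'a \<Rightarrow> (nat \<Rightarrow> 'k) \<Rightarrow> nat \<Rightarrow> 'a" where
  "primitive_idempotent smul d A \<theta> i =
     prod_list (map (\<lambda>j. smul (1 / (\<theta> i - \<theta> j)) (A - smul (\<theta> j) 1))
       (filter (\<lambda>j. j \<noteq> i) [0..<d + 1]))"

text \<open>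
  \<open>E\<close> is an ordering of the primitive idempotents of \<open>A\<close>, and \<open>\<theta> i\<close> is the eigenvalue of
  \<open>A\<close> associated with \<open>E i\<close>.
\<close>

definition associated_orderings ::
  "('k::field \<Rightarrow> 'a::ring_1 \<Rightarrow> 'a) \<Rightarrow> nat \<Rightarrow> ('a \<Rightarrow> 'k mat) \<Rightarrow>
     'a \<Rightarrow> (nat \<Rightarrow> 'a) \<Rightarrow> (nat \<Rightarrow> 'k) \<Rightarrow> bool" where
  "associated_orderings smul d f A E \<theta> \<longleftrightarrow>
     eigenvalue_ordering d f A \<theta> \<and> (\<forall>i\<le>d. E i = primitive_idempotent smul d A \<theta> i)"

definition leonard_system ::
  "('k::field \<Rightarrow> 'a::ring_1 \<Rightarrow> 'a) \<Rightarrow> nat \<Rightarrow> ('a \<Rightarrow> 'k mat) \<Rightarrow>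
     'a \<Rightarrow> (nat \<Rightarrow> 'a) \<Rightarrow> 'a \<Rightarrow> (nat \<Rightarrow> 'a) \<Rightarrow> bool" where
  "leonard_system smul d f A E As Es \<longleftrightarrow>
     multiplicity_free d f A \<and> multiplicity_free d f As \<and>
     (\<exists>\<theta>. associated_orderings smul d f A E \<theta>) \<and>
     (\<exists>\<theta>s. associated_orderings smul d f As Es \<theta>s) \<and>
     (\<forall>i\<le>d. \<forall>j\<le>d.
        (\<bar>int i - int j\<bar> > 1 \<longrightarrow> E i * As * E j = 0 \<and> Es i * A * Es j = 0) \<and>
        (\<bar>int i - int j\<bar> = 1 \<longrightarrow> E i * As * E j \<noteq> 0 \<and> Es i * A * Es j \<noteq> 0))"

definition poly_at :: "('k::field \<Rightarrow> 'a::ring_1 \<Rightarrow> 'a) \<Rightarrow> 'k poly \<Rightarrow> 'a \<Rightarrow> 'a" where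
  "poly_at smul p X = (\<Sum>k\<le>degree p. smul (coeff p k) (X ^ k))"

definition tau :: "(nat \<Rightarrow> 'k::field) \<Rightarrow> nat \<Rightarrow> 'k poly" where
  "tau \<theta> i = (\<Prod>h<i. [:- \<theta> h, 1:])"

definition eta :: "nat \<Rightarrow> (nat \<Rightarrow> 'k::field) \<Rightarrow> nat \<Rightarrow> 'k poly" where
  "eta d \<theta> i = (\<Prod>h<i. [:- \<theta> (d - h), 1:])"

text \<open>
  The split sequences, meaningful for \<open>1 \<le> i \<le> d\<close>.
\<close>

definition first_split ::
  "('k::field \<Rightarrow> 'a::ring_1 \<Rightarrow> 'a) \<Rightarrow> nat \<Rightarrow> ('a \<Rightarrow> 'k mat) \<Rightarrow>
     'a \<Rightarrow> (nat \<Rightarrow> 'k) \<Rightarrow> (nat \<Rightarrow> 'a) \<Rightarrow> (nat \<Rightarrow> 'k) \<Rightarrow> nat \<Rightarrow> 'k" where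
  "first_split smul d f A \<theta> Es \<theta>s i =
     (\<theta>s 0 - \<theta>s i) *
     (alg_trace d f (poly_at smul (tau \<theta> i) A * Es 0) /
      alg_trace d f (poly_at smul (tau \<theta> (i - 1)) A * Es 0))"

definition second_split ::
  "('k::field \<Rightarrow> 'a::ring_1 \<Rightarrow> 'a) \<Rightarrow> nat \<Rightarrow> ('a \<Rightarrow> 'k mat) \<Rightarrow>
     'a \<Rightarrow> (nat \<Rightarrow> 'k) \<Rightarrow> (nat \<Rightarrow> 'a) \<Rightarrow> (nat \<Rightarrow> 'k) \<Rightarrow> nat \<Rightarrow> 'k" where
  "second_split smul d f A \<theta> Es \<theta>s i =
     (\<theta>s 0 - \<theta>s i) *
     (alg_trace d f (poly_at smul (eta d \<theta> i) A * Es 0) /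
      alg_trace d f (poly_at smul (eta d \<theta> (i - 1)) A * Es 0))"

definition switching_element ::
  "('k::field \<Rightarrow> 'a::ring_1 \<Rightarrow> 'a) \<Rightarrow> nat \<Rightarrow> ('a \<Rightarrow> 'k mat) \<Rightarrow>
     'a \<Rightarrow> (nat \<Rightarrow> 'a) \<Rightarrow> (nat \<Rightarrow> 'k) \<Rightarrow> (nat \<Rightarrow> 'a) \<Rightarrow> (nat \<Rightarrow> 'k) \<Rightarrow> 'a" where
  "switching_element smul d f A E \<theta> Es \<theta>s =
     (\<Sum>r\<le>d. smul
        ((\<Prod>h<r. second_split smul d f A \<theta> Es \<theta>s (d - h)) /
         (\<Prod>h=1..r. first_split smul d f A \<theta> Es \<theta>s h))
        (E r))"

text \<open>
  The names of the four flags \<open>[0]\<close>, \<open>[D]\<close>, \<open>[0*]\<close>, \<open>[D*]\<close>. In the definition of \<open>flag\<close> the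
  sum is the sum of subsets of \<open>V\<close> from \<open>HOL-Library.Set_Algebras\<close>.
\<close>

datatype flag_name = Flag0 | FlagD | Flag0s | FlagDs

fun flag ::
  "nat \<Rightarrow> ('a::ring_1 \<Rightarrow> 'v::ab_group_add \<Rightarrow> 'v) \<Rightarrow> (nat \<Rightarrow> 'a) \<Rightarrow> (nat \<Rightarrow> 'a) \<Rightarrow>
     flag_name \<Rightarrow> nat \<Rightarrow> 'v set" where
  "flag d act E Es Flag0 i = (\<Sum>h\<le>i. range (act (E h)))"
| "flag d act E Es FlagD i = (\<Sum>h\<le>i. range (act (E (d - h))))"
| "flag d act E Es Flag0s i = (\<Sum>h\<le>i. range (act (Es h)))"
| "flag d act E Es FlagDs i = (\<Sum>h\<le>i. range (act (Es (d - h))))"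

definition decomposition ::
  "nat \<Rightarrow> ('a::ring_1 \<Rightarrow> 'v::ab_group_add \<Rightarrow> 'v) \<Rightarrow> (nat \<Rightarrow> 'a) \<Rightarrow> (nat \<Rightarrow> 'a) \<Rightarrow>
     flag_name \<Rightarrow> flag_name \<Rightarrow> nat \<Rightarrow> 'v set" where
  "decomposition d act E Es z w i = flag d act E Es z i \<inter> flag d act E Es w (d - i)"

definition seq_image ::
  "('a::ring_1 \<Rightarrow> 'v::ab_group_add \<Rightarrow> 'v) \<Rightarrow> 'a \<Rightarrow> (nat \<Rightarrow> 'v set) \<Rightarrow> nat \<Rightarrow> 'v set" where
  "seq_image act X F i = act X ` F i"

definition seq_subset :: "nat \<Rightarrow> (nat \<Rightarrow> 'v set) \<Rightarrow> (nat \<Rightarrow> 'v set) \<Rightarrow> bool" where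
  "seq_subset d F F' \<longleftrightarrow> (\<forall>i\<le>d. F i \<subseteq> F' i)"

definition seq_equal :: "nat \<Rightarrow> (nat \<Rightarrow> 'v set) \<Rightarrow> (nat \<Rightarrow> 'v set) \<Rightarrow> bool" where
  "seq_equal d F F' \<longleftrightarrow> (\<forall>i\<le>d. F i = F' i)"

end

theory Submission
  imports Defs
begin

text \<open>
  Write \<open>v\<^sub>r = E\<^sub>r w\<close>, where \<open>w\<close> spans \<open>E*\<^sub>0V\<close>. The vector \<open>w\<close> is cyclic for \<open>A\<close>, and more precisely
  \<open>[0*]\<^sub>i\<close> consists of the vectors \<open>p(A) w\<close> with \<open>deg p \<le> i\<close>. Hence no \<open>v\<^sub>r\<close> vanishes, and
  the lines \<open>[0*D]\<^sub>i\<close> and \<open>[0*0]\<^sub>i\<close> are spanned by \<open>\<tau>\<^sub>i(A) w\<close> and \<open>\<eta>\<^sub>i(A) w\<close>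
  (\<open>split_line\<close>). Reversing the order of the \<open>E*\<^sub>i\<close> turns this into a description of \<open>[D*D]\<^sub>i\<close>
  and \<open>[D*0]\<^sub>i\<close> by a vector spanning \<open>E*\<^sub>dV\<close>. Since \<open>S\<close> commutes with \<open>A\<close>, the inclusions for
  \<open>S\<close>, with equality, all follow from the single claim \<open>0 \<noteq> S w \<in> E*\<^sub>dV\<close>.

  For this claim let \<open>t\<^sub>r\<^sub>s\<close> be the entries of \<open>A*\<close> in the basis \<open>v\<^sub>0, \<dots>, v\<^sub>d\<close>; they form an
  irreducible tridiagonal matrix. Since \<open>A* - \<theta>*\<^sub>i\<close> maps \<open>\<tau>\<^sub>i(A) w\<close> to a multiple of
  \<open>\<tau>\<^sub>i\<^sub>-\<^sub>1(A) w\<close>, and that multiple is read off as the trace quotient \<open>\<phi>\<^sub>i\<close> of the first split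
  sequence, the superdiagonal entries are \<open>\<phi>\<^sub>r\<close> times a ratio of values of the polynomials
  \<open>\<tau>\<^sub>i\<close> (\<open>phi_entry\<close>); likewise the subdiagonal entries come from the second split sequence
  (\<open>phi'_entry\<close>). Now let \<open>y\<close> be the functional on \<open>V\<close> giving the \<open>E*\<^sub>d\<close>-coordinate. It kills
  \<open>[0*]\<^sub>d\<^sub>-\<^sub>1\<close>, that is, all \<open>p(A) w\<close> with \<open>deg p < d\<close>, so its values
  \<open>y(v\<^sub>r)\<close> are up to a common factor the Lagrange weights \<open>1 / \<Prod>\<^sub>j\<^sub>\<noteq>\<^sub>r (\<theta>\<^sub>r - \<theta>\<^sub>j)\<close>
  (\<open>last_coord_step\<close>). Together these facts say that the coefficients \<open>c\<^sub>r\<close> of \<open>S\<close> satisfy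
  \<open>c\<^sub>s t\<^sub>r\<^sub>s y(v\<^sub>r) = c\<^sub>r t\<^sub>s\<^sub>r y(v\<^sub>s)\<close> (\<open>entry_symmetrize\<close>). This identity converts the equation
  \<open>y(A* x) = \<theta>*\<^sub>d y(x)\<close> into \<open>A* S w = \<theta>*\<^sub>d S w\<close> (\<open>switching_w_eigen\<close>).

  Conversely, let \<open>X\<close> satisfy the inclusions. It then maps each \<open>\<tau>\<^sub>i(A) w\<close> into
  \<open>E\<^sub>iV + \<dots> + E\<^sub>dV\<close> and each \<open>\<eta>\<^sub>i(A) w\<close> into \<open>E\<^sub>0V + \<dots> + E\<^sub>d\<^sub>-\<^sub>iV\<close>, so it preserves the flags \<open>[D]\<close>
  and \<open>[0]\<close> and hence every line \<open>E\<^sub>rV\<close>. Also \<open>X w\<close> lies in \<open>E*\<^sub>dV\<close>, so \<open>X w = k S w\<close>;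
  comparing the components in \<open>E\<^sub>rV\<close> shows that \<open>X\<close> and \<open>k S\<close> agree on each \<open>v\<^sub>r\<close>
  (\<open>eq_multiple_switching\<close>), and \<open>V\<close> is faithful.
\<close>

section \<open>Diagonalizing a multiplicity-free element\<close>

context full_matrix_algebra
begin

lemma iso_carrier [simp]: "f x \<in> carrier_mat (d + 1) (d + 1)"
  using iso_bij by (auto simp: bij_betw_def)

lemma iso_carrier_Suc [simp]: "f x \<in> carrier_mat (Suc d) (Suc d)"
  using iso_carrier by simp

lemma iso_dim [simp]: "dim_row (f x) = Suc d" "dim_col (f x) = Suc d"
  using iso_carrier_Suc by blast+

lemma iso_inject: "f x = f y \<Longrightarrow> x = y"
  using iso_bij by (auto simp: bij_betw_def inj_on_def)

lemma iso_zero: "f 0 = 0\<^sub>m (d + 1) (d + 1)"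
proof -
  have "f (smul 0 1) = 0 \<cdot>\<^sub>m f 1" by (rule iso_smul)
  then show ?thesis by (auto simp: iso_one intro!: eq_matI)
qed

lemma iso_diff: "f (x - y) = f x - f y"
proof -
  have "f x = f (x - y) + f y"
    using iso_add[of "x - y" y] by simp
  moreover have "f (x - y) + f y - f y = f (x - y)"
    by (auto intro!: eq_matI)
  ultimately show ?thesis by simp
qed

text \<open>
  If the columns of \<open>P\<close> are eigenvectors of \<open>A\<close>, then the \<open>i\<close>th idempotent of \<open>A\<close> is carried
  by \<open>P\<close> to the \<open>i\<close>th diagonal matrix unit, because each factor of the defining product is
  carried to a diagonal matrix. Invertibility of \<open>P\<close> will be deduced from this: the idempotents
  separate the eigenvectors.
\<close>

lemma primitive_idempotent_intertwine:
  assumes P: "P \<in> carrier_mat (d + 1) (d + 1)"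
    and AP: "f A * P = P * mat_diag (d + 1) \<theta>"
    and inj: "inj_on \<theta> {0..d}" and i: "i \<le> d"
  shows "f (primitive_idempotent smul d A \<theta> i) * P
    = P * mat_diag (d + 1) (\<lambda>k. if k = i then 1 else 0)"
proof -
  let ?c = "\<lambda>j k. (\<theta> k - \<theta> j) / (\<theta> i - \<theta> j)"
  have factor: "f (smul (1 / (\<theta> i - \<theta> j)) (A - smul (\<theta> j) 1)) * P = P * mat_diag (d + 1) (?c j)"
    for j
  proof -
    have "f (A - smul (\<theta> j) 1) * P = f A * P - (\<theta> j \<cdot>\<^sub>m 1\<^sub>m (d + 1)) * P"
      unfolding iso_diff iso_smul iso_one by (rule minus_mult_distrib_mat) (use P in auto)
    also have "\<dots> = P * mat_diag (d + 1) \<theta> - \<theta> j \<cdot>\<^sub>m P"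
      using P by (simp add: AP mult_smult_assoc_mat[of _ "Suc d" "Suc d" _ "Suc d"])
    also have "\<dots> = P * mat_diag (d + 1) (\<lambda>k. \<theta> k - \<theta> j)"
      unfolding mat_diag_mult_right[OF P]
      using P by (auto intro!: eq_matI simp: algebra_simps)
    finally have *: "f (A - smul (\<theta> j) 1) * P = P * mat_diag (d + 1) (\<lambda>k. \<theta> k - \<theta> j)" .
    show ?thesis
      unfolding iso_smul mult_smult_assoc_mat[OF iso_carrier P] * mat_diag_mult_right[OF P]
      using P by (auto intro!: eq_matI)
  qed
  have prod: "f (prod_list (map (\<lambda>j. smul (1 / (\<theta> i - \<theta> j)) (A - smul (\<theta> j) 1)) js)) * P
      = P * mat_diag (d + 1) (\<lambda>k. prod_list (map (\<lambda>j. ?c j k) js))" for js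
  proof (induction js)
    case Nil
    show ?case using P by (simp add: iso_one)
  next
    case (Cons j js)
    let ?x = "smul (1 / (\<theta> i - \<theta> j)) (A - smul (\<theta> j) 1)"
    let ?y = "prod_list (map (\<lambda>j. smul (1 / (\<theta> i - \<theta> j)) (A - smul (\<theta> j) 1)) js)"
    let ?u = "mat_diag (d + 1) (\<lambda>k. prod_list (map (\<lambda>j. ?c j k) js))"
    have "f (?x * ?y) * P = f ?x * (f ?y * P)"
      unfolding iso_mult by (rule assoc_mult_mat) (use P in auto)
    also have "\<dots> = f ?x * (P * ?u)"
      by (simp only: Cons.IH)
    also have "\<dots> = (f ?x * P) * ?u"
      by (rule assoc_mult_mat[OF iso_carrier P mat_diag_dim, symmetric])
    also have "\<dots> = P * (mat_diag (d + 1) (?c j) * ?u)"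
      unfolding factor by (rule assoc_mult_mat[OF P mat_diag_dim mat_diag_dim])
    finally show ?case by simp
  qed
  have "prod_list (map (\<lambda>j. ?c j k) (filter (\<lambda>j. j \<noteq> i) [0..<d + 1])) = (if k = i then 1 else 0)"
    if k: "k < d + 1" for k
  proof (cases "k = i")
    case True
    have "\<theta> i \<noteq> \<theta> j" if "j < d + 1" "j \<noteq> i" for j
      using inj that i by (auto dest!: inj_onD)
    then have "map (\<lambda>j. ?c j i) (filter (\<lambda>j. j \<noteq> i) [0..<d + 1])
        = map (\<lambda>j. 1) (filter (\<lambda>j. j \<noteq> i) [0..<d + 1])"
      by (intro map_cong refl) (simp del: upt_Suc)
    then show ?thesis by (simp only: True map_replicate_const prod_list_replicate) simp
  next
    case False
    then have "0 \<in> set (map (\<lambda>j. ?c j k) (filter (\<lambda>j. j \<noteq> i) [0..<d + 1]))"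
      using k by (auto simp: image_iff simp del: upt_Suc intro!: bexI[of _ k])
    then show ?thesis using False by (simp only: prod_list_zero_iff) simp
  qed
  then have diag: "mat_diag (d + 1) (\<lambda>k. prod_list (map (\<lambda>j. ?c j k) (filter (\<lambda>j. j \<noteq> i) [0..<d + 1])))
      = mat_diag (d + 1) (\<lambda>k. if k = i then 1 else 0)"
    unfolding mat_diag_def by (auto intro!: eq_matI)
  show ?thesis
    unfolding primitive_idempotent_def prod diag ..
qed

text \<open>
  A change of basis of the matrices changes neither the hypotheses on the isomorphism nor the
  traces, so the basis can be adapted to one element at a time.
\<close>

lemma conjugate_full_matrix_algebra:
  assumes P: "P \<in> carrier_mat (d + 1) (d + 1)" and Q: "Q \<in> carrier_mat (d + 1) (d + 1)"
    and PQ: "P * Q = 1\<^sub>m (d + 1)" and QP: "Q * P = 1\<^sub>m (d + 1)"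
  shows "full_matrix_algebra smul d (\<lambda>x. Q * f x * P)"
proof
  have to_and_fro: "P * (Q * M * P) * Q = M" if M: "M \<in> carrier_mat (d + 1) (d + 1)" for M
  proof -
    have "P * (Q * M * P) * Q = (P * Q) * M * (P * Q)"
      using P Q M by (simp add: assoc_mult_mat[of _ "Suc d" "Suc d" _ "Suc d" _ "Suc d"])
    then show ?thesis using PQ M by simp
  qed
  have fro_and_to: "Q * (P * M * Q) * P = M" if M: "M \<in> carrier_mat (d + 1) (d + 1)" for M
  proof -
    have "Q * (P * M * Q) * P = (Q * P) * M * (Q * P)"
      using P Q M by (simp add: assoc_mult_mat[of _ "Suc d" "Suc d" _ "Suc d" _ "Suc d"])
    then show ?thesis using QP M by simp
  qed
  have "bij_betw (\<lambda>M. Q * M * P) (carrier_mat (d + 1) (d + 1)) (carrier_mat (d + 1) (d + 1))"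
    by (rule bij_betw_byWitness[where f' = "\<lambda>M. P * M * Q"])
       (use P Q to_and_fro fro_and_to in \<open>auto simp: image_subset_iff\<close>)
  from bij_betw_trans[OF iso_bij this]
  show "bij_betw (\<lambda>x. Q * f x * P) UNIV (carrier_mat (d + 1) (d + 1))"
    by (simp add: comp_def)
next
  fix x y c
  show "Q * f (x + y) * P = Q * f x * P + Q * f y * P"
    using P Q by (simp add: iso_add mult_add_distrib_mat[of _ "Suc d" "Suc d" _ "Suc d"]
        add_mult_distrib_mat[of _ "Suc d" "Suc d" _ _ "Suc d"])
  have "P * (Q * Z) = Z" if "Z \<in> carrier_mat (Suc d) (Suc d)" for Z
    using P Q PQ that assoc_mult_mat[of P "Suc d" "Suc d" Q "Suc d" Z "Suc d"] by simp
  then show "Q * f (x * y) * P = Q * f x * P * (Q * f y * P)"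
    using P Q by (simp add: iso_mult assoc_mult_mat[of _ "Suc d" "Suc d" _ "Suc d" _ "Suc d"]
        mult_carrier_mat[of _ "Suc d" "Suc d" _ "Suc d"])
  show "Q * f 1 * P = 1\<^sub>m (d + 1)"
    using P Q QP by (simp add: iso_one)
  show "Q * f (smul c x) * P = c \<cdot>\<^sub>m (Q * f x * P)"
    using P Q by (simp add: iso_smul mult_smult_distrib[of _ "Suc d" "Suc d" _ "Suc d"]
        mult_smult_assoc_mat[of _ "Suc d" "Suc d" _ "Suc d"])
qed

lemma alg_trace_conjugate:
  assumes P: "P \<in> carrier_mat (d + 1) (d + 1)" and Q: "Q \<in> carrier_mat (d + 1) (d + 1)"
    and PQ: "P * Q = 1\<^sub>m (d + 1)"
  shows "alg_trace d (\<lambda>x. Q * f x * P) x = alg_trace d f x"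
proof -
  have comm: "(\<Sum>i<d + 1. (M * N) $$ (i, i)) = (\<Sum>i<d + 1. (N * M) $$ (i, i))"
    if "M \<in> carrier_mat (d + 1) (d + 1)" "N \<in> carrier_mat (d + 1) (d + 1)" for M N :: "'k mat"
    using that by (simp add: scalar_prod_def mult.commute lessThan_atLeast0 sum.swap[of _ "{0..<d}"]
         del: sum.op_ivl_Suc) (subst sum.swap, simp)
  have "(\<Sum>i<d + 1. (Q * (f x * P)) $$ (i, i)) = (\<Sum>i<d + 1. ((f x * P) * Q) $$ (i, i))"
    by (rule comm) (use P Q in auto)
  also have "(f x * P) * Q = f x"
    using P Q PQ iso_carrier[of x] by (simp add: assoc_mult_mat[of _ "Suc d" "Suc d" _ "Suc d" _ "Suc d"])
  also have "Q * (f x * P) = Q * f x * P"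
    using P Q by (simp add: assoc_mult_mat[of _ "Suc d" "Suc d" _ "Suc d" _ "Suc d"])
  finally show ?thesis by (simp add: alg_trace_def)
qed

text \<open>
  In a basis of eigenvectors of \<open>A\<close> the idempotents \<open>E i\<close> become diagonal matrix units, which
  makes their products, their sum and the traces \<open>tr (x E\<^sub>i)\<close> visible.
\<close>

lemma diagonalizing_isomorphism:
  assumes ord: "associated_orderings smul d f A E \<theta>"
  obtains g where "full_matrix_algebra smul d g"
    and "\<And>x. alg_trace d g x = alg_trace d f x"
    and "g A = mat_diag (d + 1) \<theta>"
    and "\<And>i. i \<le> d \<Longrightarrow> g (E i) = mat_diag (d + 1) (\<lambda>k. if k = i then 1 else 0)"
proof -
  have bij: "bij_betw \<theta> {0..d} (eigenvalues_of f A)"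
    and E: "\<And>i. i \<le> d \<Longrightarrow> E i = primitive_idempotent smul d A \<theta> i"
    using ord by (auto simp: associated_orderings_def eigenvalue_ordering_def)
  have inj: "inj_on \<theta> {0..d}"
    using bij by (simp add: bij_betw_def)
  have "\<forall>i\<in>{0..d}. \<exists>\<xi>. eigenvector (f A) \<xi> (\<theta> i)"
    using bij by (auto simp: bij_betw_def eigenvalues_of_def eigenvalue_def)
  then obtain \<xi> where "\<forall>i\<in>{0..d}. eigenvector (f A) (\<xi> i) (\<theta> i)" by metis
  moreover have "dim_row (f A) = d + 1" using iso_carrier[of A] by auto
  ultimately have \<xi>: "\<xi> i \<in> carrier_vec (d + 1)" "\<xi> i \<noteq> 0\<^sub>v (d + 1)"
    "f A *\<^sub>v \<xi> i = \<theta> i \<cdot>\<^sub>v \<xi> i" if "i \<le> d" for i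
    using that by (auto simp: eigenvector_def)
  define P where "P = Matrix.mat (d + 1) (d + 1) (\<lambda>(r, i). \<xi> i $ r)"
  have P: "P \<in> carrier_mat (d + 1) (d + 1)" by (simp add: P_def)
  have colP: "col P i = \<xi> i" if "i \<le> d" for i
    using \<xi>(1)[OF that] that by (auto simp: P_def)
  have AP: "f A * P = P * mat_diag (d + 1) \<theta>"
  proof (rule eq_matI)
    fix r i assume "r < dim_row (P * mat_diag (d + 1) \<theta>)" "i < dim_col (P * mat_diag (d + 1) \<theta>)"
    then have r: "r \<le> d" and i: "i \<le> d" using P by (auto simp: mat_diag_def)
    have "(f A * P) $$ (r, i) = (f A *\<^sub>v col P i) $ r"
      using r i P iso_carrier[of A] by auto
    also have "\<dots> = \<theta> i * \<xi> i $ r"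
      using \<xi>[OF i] colP[OF i] r by simp
    also have "\<dots> = (P * mat_diag (d + 1) \<theta>) $$ (r, i)"
      using r i by (subst mat_diag_mult_right[OF P], simp, simp add: P_def)
    finally show "(f A * P) $$ (r, i) = (P * mat_diag (d + 1) \<theta>) $$ (r, i)" .
  qed (use P iso_carrier[of A] in \<open>auto simp: mat_diag_def\<close>)
  note EP = primitive_idempotent_intertwine[OF P AP inj]
  \<comment> \<open>A vector \<open>v\<close> in the kernel of \<open>P\<close> is split by the idempotents into the multiples
    \<open>v i\<close> of the eigenvectors \<open>\<xi> i\<close>, each of which must then vanish.\<close>
  have "det P \<noteq> 0"
  proof
    assume "det P = 0"
    then obtain v where v: "v \<in> carrier_vec (d + 1)" "v \<noteq> 0\<^sub>v (d + 1)" "P *\<^sub>v v = 0\<^sub>v (d + 1)"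
      using det_0_iff_vec_prod_zero_field[OF P] by auto
    have "v $ i = 0" if i: "i \<le> d" for i
    proof (rule ccontr)
      assume vi: "v $ i \<noteq> 0"
      let ?e = "mat_diag (d + 1) (\<lambda>k. if k = i then 1 else 0) :: 'k mat"
      have "(P * ?e) *\<^sub>v v = f (primitive_idempotent smul d A \<theta> i) *\<^sub>v (P *\<^sub>v v)"
        unfolding EP[OF i, symmetric] by (rule assoc_mult_mat_vec) (use P v in auto)
      also have "\<dots> = 0\<^sub>v (d + 1)"
        unfolding v(3) using iso_carrier[of "primitive_idempotent smul d A \<theta> i"]
        by (auto intro!: eq_vecI)
      finally have z: "(P * ?e) *\<^sub>v v = 0\<^sub>v (d + 1)" .
      have "\<xi> i $ r = 0" if r: "r < d + 1" for r
      proof -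
        have "((P * ?e) *\<^sub>v v) $ r = (\<Sum>k<d + 1. P $$ (r, k) * (if k = i then 1 else 0) * v $ k)"
          unfolding mat_diag_mult_right[OF P]
          using r v by (simp add: scalar_prod_def lessThan_atLeast0)
        also have "\<dots> = (\<Sum>k<d + 1. if k = i then P $$ (r, i) * v $ i else 0)"
          by (intro sum.cong) auto
        also have "\<dots> = \<xi> i $ r * v $ i"
          using i r by (simp add: sum.delta P_def)
        finally show ?thesis using vi r unfolding z by simp
      qed
      then show False using \<xi>[OF i] by (auto intro!: eq_vecI)
    qed
    then show False using v by (auto intro!: eq_vecI)
  qed
  from det_non_zero_imp_unit[OF P this, of "()"]
  obtain Q where Q: "Q \<in> carrier_mat (d + 1) (d + 1)"
    and QP: "Q * P = 1\<^sub>m (d + 1)" and PQ: "P * Q = 1\<^sub>m (d + 1)"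
    unfolding Units_def ring_mat_def by auto
  have diag: "Q * f x * P = mat_diag (d + 1) u" if "f x * P = P * mat_diag (d + 1) u" for x u
  proof -
    have "Q * f x * P = Q * (P * mat_diag (d + 1) u)"
      using P Q that assoc_mult_mat[OF Q iso_carrier P] by simp
    also have "\<dots> = Q * P * mat_diag (d + 1) u"
      using P Q by (simp add: assoc_mult_mat[of _ "Suc d" "Suc d" _ "Suc d" _ "Suc d"])
    finally show ?thesis by (simp add: QP left_mult_one_mat[OF mat_diag_dim, simplified])
  qed
  show thesis
    by (rule that[of "\<lambda>x. Q * f x * P", OF conjugate_full_matrix_algebra[OF P Q PQ QP]
            alg_trace_conjugate[OF P Q PQ] diag[OF AP]])
       (use E EP diag in auto)
qed

end

section \<open>Modules with a complete system of eigenlines\<close>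

locale algebra_module = algebra_over_field smul + left_module act
  for smul :: "'k::field \<Rightarrow> 'a::ring_1 \<Rightarrow> 'a"
    and act :: "'a \<Rightarrow> 'v::ab_group_add \<Rightarrow> 'v"
begin

definition sc :: "'k \<Rightarrow> 'v \<Rightarrow> 'v" where
  "sc c v = act (smul c 1) v"

lemma act_smul: "act (smul c x) v = sc c (act x v)"
  using smul_mult_left[of c 1 x] by (simp add: sc_def act_mult[symmetric])

lemma act_sc: "act x (sc c v) = sc c (act x v)"
  by (simp add: sc_def act_mult[symmetric] smul_mult_left smul_mult_right)

sublocale V: vector_space sc
proof
  fix a b x y
  show "sc a (x + y) = sc a x + sc a y" by (simp add: sc_def act_add_right)
  show "sc (a + b) x = sc a x + sc b x"
    by (simp add: sc_def scale_left_distrib act_add_left)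
  show "sc a (sc b x) = sc (a * b) x"
    using act_smul[of a "smul b 1" x] by (simp add: sc_def)
  show "sc 1 x = x" by (simp add: sc_def act_one)
qed

lemma act_zero_right [simp]: "act x 0 = 0"
  using act_add_right[of x 0 0] by simp

lemma act_zero_left [simp]: "act 0 v = 0"
  using act_add_left[of 0 0 v] by simp

lemma act_diff_right: "act x (v - w) = act x v - act x w"
  using act_add_right[of x "v - w" w] by (simp add: algebra_simps)

lemma act_diff_left: "act (x - y) v = act x v - act y v"
  using act_add_left[of "x - y" y v] by (simp add: algebra_simps)

lemma act_sum_right: "act x (sum g I) = (\<Sum>i\<in>I. act x (g i))"
  by (induction I rule: infinite_finite_induct) (simp_all add: act_add_right)

lemma act_sum_left: "act (sum g I) v = (\<Sum>i\<in>I. act (g i) v)"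
  by (induction I rule: infinite_finite_induct) (simp_all add: act_add_left)

end

text \<open>
  This abstracts a multiplicity-free element \<open>A\<close> acting on a simple module: the \<open>E i\<close> form a
  complete system of orthogonal idempotents, each projecting onto an eigenline of \<open>A\<close>. The
  order of the eigenvalues is arbitrary, so every consequence can also be read for the
  reversed order; this exchanges the flags \<open>[0]\<close> and \<open>[D]\<close>.
\<close>

locale eigenline_system = algebra_module smul act
  for smul :: "'k::field \<Rightarrow> 'a::ring_1 \<Rightarrow> 'a"
    and act :: "'a \<Rightarrow> 'v::ab_group_add \<Rightarrow> 'v"
    and d :: nat and A :: 'a and E :: "nat \<Rightarrow> 'a" and \<theta> :: "nat \<Rightarrow> 'k" +
  assumes inj: "i \<le> d \<Longrightarrow> j \<le> d \<Longrightarrow> \<theta> i = \<theta> j \<Longrightarrow> i = j"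
    and idem: "i \<le> d \<Longrightarrow> j \<le> d \<Longrightarrow> E i * E j = (if i = j then E i else 0)"
    and complete: "(\<Sum>i\<le>d. E i) = 1"
    and eigen: "i \<le> d \<Longrightarrow> A * E i = smul (\<theta> i) (E i)"
    and line: "i \<le> d \<Longrightarrow> act (E i) v = v \<Longrightarrow> v \<noteq> 0 \<Longrightarrow> \<exists>c. act (E i) x = sc c v"
    and line_nonzero: "i \<le> d \<Longrightarrow> \<exists>v. act (E i) v \<noteq> 0"
begin

lemma act_E_E: "i \<le> d \<Longrightarrow> j \<le> d \<Longrightarrow> act (E i) (act (E j) x) = (if i = j then act (E i) x else 0)"
  using idem[of i j] by (simp add: act_mult[symmetric])

lemma sum_E: "x = (\<Sum>i\<le>d. act (E i) x)"
  using act_sum_left[of E "{..d}" x] by (simp add: complete act_one)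

lemma act_A_E: "i \<le> d \<Longrightarrow> act A (act (E i) x) = sc (\<theta> i) (act (E i) x)"
  using eigen[of i] by (simp add: act_mult[symmetric] act_smul[symmetric])

lemma vec_eqI: "(\<And>i. i \<le> d \<Longrightarrow> act (E i) x = act (E i) y) \<Longrightarrow> x = y"
  using sum_E[of x] sum_E[of y] by simp

lemma act_E_sum:
  assumes "i \<le> d"
  shows "act (E i) (\<Sum>j\<le>d. sc (g j) (act (E j) x)) = sc (g i) (act (E i) x)"
proof -
  have "act (E i) (\<Sum>j\<le>d. sc (g j) (act (E j) x)) = (\<Sum>j\<le>d. if j = i then sc (g i) (act (E i) x) else 0)"
    unfolding act_sum_right act_sc
    by (intro sum.cong refl) (use assms in \<open>simp add: act_E_E\<close>)
  then show ?thesis using assms by simp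
qed

lemma act_E_A:
  assumes "i \<le> d"
  shows "act (E i) (act A x) = sc (\<theta> i) (act (E i) x)"
proof -
  have "act A x = (\<Sum>j\<le>d. sc (\<theta> j) (act (E j) x))"
    by (subst sum_E[of x]) (simp add: act_sum_right act_A_E)
  then show ?thesis using act_E_sum[OF assms] by simp
qed

lemma act_E_poly_at:
  assumes "i \<le> d"
  shows "act (E i) (act (poly_at smul p A) x) = sc (poly p (\<theta> i)) (act (E i) x)"
proof -
  have "act (E i) (act (A ^ k) x) = sc (\<theta> i ^ k) (act (E i) x)" for k
    by (induction k) (simp_all add: act_one act_mult act_E_A[OF assms] V.scale_scale)
  then show ?thesis
    by (simp add: poly_at_def act_sum_left act_sum_right act_smul act_sc poly_altdef
        V.scale_sum_left)
qed

lemma eigenvector_E: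
  assumes "i \<le> d" and "act A x = sc (\<theta> i) x"
  shows "act (E i) x = x"
proof (rule vec_eqI)
  fix j assume j: "j \<le> d"
  have "\<theta> j = \<theta> i \<or> act (E j) x = 0"
    using act_E_A[OF j, of x] assms(2) by (auto simp: act_sc)
  then have "j = i \<or> act (E j) x = 0"
    using inj[OF j assms(1)] by blast
  then show "act (E j) (act (E i) x) = act (E j) x"
    using assms(1) j by (auto simp: act_E_E)
qed

text \<open>
  The two flags of \<open>A\<close>, \<open>low i = E\<^sub>0V + \<dots> + E\<^sub>iV\<close> and \<open>up i = E\<^sub>iV + \<dots> + E\<^sub>dV\<close>. Describing
  them by the components that vanish makes membership a matter of applying the idempotents.
  The index of \<open>up\<close> is its first line: the \<open>i\<close>th component of the flag \<open>[D]\<close> is \<open>up (d - i)\<close>.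
\<close>

definition low :: "nat \<Rightarrow> 'v set" where
  "low i = {x. \<forall>h\<le>d. i < h \<longrightarrow> act (E h) x = 0}"

definition up :: "nat \<Rightarrow> 'v set" where
  "up i = {x. \<forall>h\<le>d. h < i \<longrightarrow> act (E h) x = 0}"

lemma sum_range_E:
  assumes "I \<subseteq> {..d}"
  shows "(\<Sum>h\<in>I. range (act (E h))) = {x. \<forall>h\<le>d. h \<notin> I \<longrightarrow> act (E h) x = 0}"
proof -
  have fin: "finite I" using assms finite_subset by blast
  show ?thesis
  proof (intro equalityI subsetI)
    fix x assume "x \<in> (\<Sum>h\<in>I. range (act (E h)))"
    then obtain s where s: "x = sum s I" "\<forall>h\<in>I. s h \<in> range (act (E h))"
      using set_sum_alt[OF fin, of "\<lambda>h. range (act (E h))"] by auto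
    have "act (E j) x = 0" if j: "j \<le> d" "j \<notin> I" for j
      unfolding s(1) act_sum_right
    proof (rule sum.neutral, intro ballI)
      fix h assume h: "h \<in> I"
      then obtain y where "s h = act (E h) y" using s(2) by auto
      moreover have "h \<le> d" "h \<noteq> j" using h assms j by auto
      ultimately show "act (E j) (s h) = 0" using j by (simp add: act_E_E)
    qed
    then show "x \<in> {x. \<forall>h\<le>d. h \<notin> I \<longrightarrow> act (E h) x = 0}" by simp
  next
    fix x assume "x \<in> {x. \<forall>h\<le>d. h \<notin> I \<longrightarrow> act (E h) x = 0}"
    then have "(\<Sum>h\<in>I. act (E h) x) = (\<Sum>h\<le>d. act (E h) x)"
      using assms by (intro sum.mono_neutral_left) auto
    then have "x = (\<Sum>h\<in>I. act (E h) x)" using sum_E[of x] by simp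
    then show "x \<in> (\<Sum>h\<in>I. range (act (E h)))"
      using set_sum_alt[OF fin, of "\<lambda>h. range (act (E h))"] by auto
  qed
qed

lemma sum_range_low: "i \<le> d \<Longrightarrow> (\<Sum>h\<le>i. range (act (E h))) = low i"
  by (subst sum_range_E) (auto simp: low_def)

lemma up_0 [simp]: "up 0 = UNIV" and low_d [simp]: "low d = UNIV"
  by (auto simp: up_def low_def)

lemma up_antimono: "i \<le> j \<Longrightarrow> up j \<subseteq> up i"
  by (auto simp: up_def)

lemma low_add: "x \<in> low i \<Longrightarrow> y \<in> low i \<Longrightarrow> x + y \<in> low i"
  and low_sc: "x \<in> low i \<Longrightarrow> sc c x \<in> low i"
  by (simp_all add: low_def act_add_right act_sc)

lemma up_add: "x \<in> up i \<Longrightarrow> y \<in> up i \<Longrightarrow> x + y \<in> up i"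
  and up_diff: "x \<in> up i \<Longrightarrow> y \<in> up i \<Longrightarrow> x - y \<in> up i"
  and up_sc: "x \<in> up i \<Longrightarrow> sc c x \<in> up i"
  by (simp_all add: up_def act_add_right act_diff_right act_sc)

lemma low_up_line: "i \<le> d \<Longrightarrow> x \<in> low i \<Longrightarrow> x \<in> up i \<Longrightarrow> act (E i) x = x"
  by (rule vec_eqI) (auto simp: low_def up_def act_E_E not_less_iff_gr_or_eq)

lemma reverse_eigenline_system:
  "eigenline_system smul act d A (\<lambda>i. E (d - i)) (\<lambda>i. \<theta> (d - i))"
proof
  show "(\<Sum>i\<le>d. E (d - i)) = 1"
    unfolding complete[symmetric]
    by (rule sum.reindex_bij_witness[where i = "\<lambda>i. d - i" and j = "\<lambda>i. d - i"]) auto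
next
  fix i j assume ij: "i \<le> d" "j \<le> d"
  show "E (d - i) * E (d - j) = (if i = j then E (d - i) else 0)"
  proof (cases "i = j")
    case False
    then have "d - i \<noteq> d - j" using ij by linarith
    then show ?thesis using False idem[of "d - i" "d - j"] by simp
  qed (simp add: idem)
  show "i = j" if "\<theta> (d - i) = \<theta> (d - j)"
    using inj[OF _ _ that] ij by (simp add: eq_diff_iff)
qed (simp_all add: eigen line line_nonzero)

lemma low_reverse:
  assumes "i \<le> d"
  shows "eigenline_system.low act d (\<lambda>i. E (d - i)) i = up (d - i)"
proof -
  interpret rev: eigenline_system smul act d A "\<lambda>i. E (d - i)" "\<lambda>i. \<theta> (d - i)"
    by (rule reverse_eigenline_system)
  have "(\<forall>h\<le>d. i < h \<longrightarrow> act (E (d - h)) x = 0) \<longleftrightarrow> (\<forall>h\<le>d. h < d - i \<longrightarrow> act (E h) x = 0)" for x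
  proof (intro iffI allI impI)
    fix h assume "h \<le> d" "h < d - i" and "\<forall>h\<le>d. i < h \<longrightarrow> act (E (d - h)) x = 0"
    moreover have "i < (d - h)" using \<open>h \<le> d\<close> \<open>h < d - i\<close> assms by linarith
    ultimately show "act (E h) x = 0" by (metis diff_diff_cancel diff_le_self)
  next
    fix h assume "h \<le> d" "i < h" and "\<forall>h\<le>d. h < d - i \<longrightarrow> act (E h) x = 0"
    moreover have "d - h < d - i" using \<open>h \<le> d\<close> \<open>i < h\<close> assms by linarith
    ultimately show "act (E (d - h)) x = 0" by simp
  qed
  then show ?thesis by (simp add: rev.low_def up_def)
qed

lemma up_reverse:
  assumes "i \<le> d"
  shows "eigenline_system.up act d (\<lambda>i. E (d - i)) i = low (d - i)"
proof -
  interpret rev: eigenline_system smul act d A "\<lambda>i. E (d - i)" "\<lambda>i. \<theta> (d - i)"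
    by (rule reverse_eigenline_system)
  have "(\<forall>h\<le>d. h < i \<longrightarrow> act (E (d - h)) x = 0) \<longleftrightarrow> (\<forall>h\<le>d. d - i < h \<longrightarrow> act (E h) x = 0)" for x
  proof (intro iffI allI impI)
    fix h assume "h \<le> d" "d - i < h" and "\<forall>h\<le>d. h < i \<longrightarrow> act (E (d - h)) x = 0"
    moreover have "(d - h) < i" using \<open>h \<le> d\<close> \<open>d - i < h\<close> assms by linarith
    ultimately show "act (E h) x = 0" by (metis diff_diff_cancel diff_le_self)
  next
    fix h assume "h \<le> d" "h < i" and "\<forall>h\<le>d. d - i < h \<longrightarrow> act (E h) x = 0"
    moreover have "d - i < d - h" using \<open>h \<le> d\<close> \<open>h < i\<close> assms by linarith
    ultimately show "act (E (d - h)) x = 0" by simp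
  qed
  then show ?thesis by (simp add: rev.up_def low_def)
qed

lemma sum_range_up:
  assumes "i \<le> d"
  shows "(\<Sum>h\<le>d - i. range (act (E (d - h)))) = up i"
proof -
  interpret rev: eigenline_system smul act d A "\<lambda>i. E (d - i)" "\<lambda>i. \<theta> (d - i)"
    by (rule reverse_eigenline_system)
  show ?thesis
    using rev.sum_range_low[of "d - i"] low_reverse[of "d - i"] assms by simp
qed

lemma act_E_expand: "act (E h) (act X x) = (\<Sum>j\<le>d. act (E h * X * E j) x)"
  by (subst sum_E[of x]) (simp add: act_sum_right act_mult)

text \<open>
  The intended use is for a vector \<open>b\<close> spanning the \<open>i\<close>th eigenline, so that \<open>coef i b\<close> is a
  linear functional on \<open>V\<close>.
\<close>

definition coef :: "nat \<Rightarrow> 'v \<Rightarrow> 'v \<Rightarrow> 'k" where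
  "coef i b x = (THE c. act (E i) x = sc c b)"

lemma coef_unique: "b \<noteq> 0 \<Longrightarrow> act (E i) x = sc c b \<Longrightarrow> coef i b x = c"
  unfolding coef_def by (rule the_equality) auto

context
  fixes i b
  assumes i: "i \<le> d" and b: "act (E i) b = b" "b \<noteq> 0"
begin

lemma act_E_coef: "act (E i) x = sc (coef i b x) b"
  using line[OF i b, of x] coef_unique[OF b(2), of i x] by auto

lemma coef_add: "coef i b (x + y) = coef i b x + coef i b y"
  by (rule coef_unique[OF b(2)])
     (simp add: act_add_right act_E_coef V.scale_left_distrib)

lemma coef_sc: "coef i b (sc k x) = k * coef i b x"
  by (rule coef_unique[OF b(2)]) (simp add: act_sc act_E_coef[of x])

lemma coef_zero: "coef i b 0 = 0"
  by (rule coef_unique[OF b(2)]) simp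

lemma coef_sum: "coef i b (sum g I) = (\<Sum>j\<in>I. coef i b (g j))"
  by (induction I rule: infinite_finite_induct) (simp_all add: coef_add coef_zero)

lemma coef_base: "coef i b b = 1"
  by (rule coef_unique[OF b(2)]) (simp add: b)

lemma coef_A: "coef i b (act A x) = \<theta> i * coef i b x"
  by (rule coef_unique[OF b(2)]) (simp add: act_E_A[OF i] act_E_coef[of x])

end

lemma act_poly_at_add:
  "act (poly_at smul (p + q) A) x = act (poly_at smul p A) x + act (poly_at smul q A) x"
  by (rule vec_eqI) (simp add: act_E_poly_at act_add_right V.scale_left_distrib)

lemma act_poly_at_smult: "act (poly_at smul (Polynomial.smult c p) A) x = sc c (act (poly_at smul p A) x)"
  by (rule vec_eqI) (simp add: act_E_poly_at act_sc)

lemma act_poly_at_pCons: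
  "act (poly_at smul (pCons c p) A) x = sc c x + act A (act (poly_at smul p A) x)"
  by (rule vec_eqI) (simp add: act_E_poly_at act_add_right V.scale_left_distrib act_sc act_E_A)

end

section \<open>Leonard systems and the split lines\<close>

lemma poly_tau: "poly (tau \<theta> i) t = (\<Prod>h<i. t - \<theta> h)"
  by (simp add: tau_def poly_prod)

lemma poly_eta: "poly (eta d \<theta> i) t = (\<Prod>h<i. t - \<theta> (d - h))"
  by (simp add: eta_def poly_prod)

lemma eta_eq_tau: "eta d \<theta> = tau (\<lambda>i. \<theta> (d - i))"
  by (simp add: eta_def tau_def fun_eq_iff)

lemma monic_tau: "degree (tau \<theta> i) = i" "lead_coeff (tau \<theta> i) = 1"
proof -
  show l: "lead_coeff (tau \<theta> i) = 1" 
    unfolding tau_def lead_coeff_prod by simp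
  show "degree (tau \<theta> i) = i"
    unfolding tau_def by (subst degree_prod_eq_sum_degree) auto
qed

text \<open>
  The module form of a Leonard system. The vector \<open>w\<close> spanning \<open>E*\<^sub>0V\<close> is a parameter, so that
  reversing the order of the \<open>E\<^sub>i\<close> keeps it, while reversing the order of the \<open>E*\<^sub>i\<close> replaces it
  by a chosen vector of \<open>E*\<^sub>dV\<close>. With these two reversals the results about \<open>[0*D]\<close> cover
  \<open>[0*0]\<close>, \<open>[D*D]\<close> and \<open>[D*0]\<close> as well.
\<close>

locale leonard_module = algebra_module smul act +
  A: eigenline_system smul act d A E \<theta> + As: eigenline_system smul act d As Es \<theta>s
  for smul :: "'k::field \<Rightarrow> 'a::ring_1 \<Rightarrow> 'a"
    and act :: "'a \<Rightarrow> 'v::ab_group_add \<Rightarrow> 'v"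
    and d :: nat and A As :: 'a and E Es :: "nat \<Rightarrow> 'a" and \<theta> \<theta>s :: "nat \<Rightarrow> 'k" and w :: 'v +
  assumes w: "act (Es 0) w = w" "w \<noteq> 0"
    and far: "i \<le> d \<Longrightarrow> j \<le> d \<Longrightarrow> Suc i < j \<or> Suc j < i \<Longrightarrow> E i * As * E j = 0"
    and near: "i \<le> d \<Longrightarrow> j \<le> d \<Longrightarrow> i = Suc j \<or> j = Suc i \<Longrightarrow> \<exists>x. act (E i * As * E j) x \<noteq> 0"
    and far_s: "i \<le> d \<Longrightarrow> j \<le> d \<Longrightarrow> Suc i < j \<or> Suc j < i \<Longrightarrow> Es i * A * Es j = 0"
    and near_s: "i \<le> d \<Longrightarrow> j \<le> d \<Longrightarrow> i = Suc j \<or> j = Suc i \<Longrightarrow> \<exists>x. act (Es i * A * Es j) x \<noteq> 0"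
begin

lemma reverse_E: "leonard_module smul act d A As (\<lambda>i. E (d - i)) Es (\<lambda>i. \<theta> (d - i)) \<theta>s w"
proof (intro leonard_module.intro leonard_module_axioms.intro)
  show "eigenline_system smul act d A (\<lambda>i. E (d - i)) (\<lambda>i. \<theta> (d - i))"
    by (rule A.reverse_eigenline_system)
  fix i j assume "i \<le> d" "j \<le> d"
  then show "E (d - i) * As * E (d - j) = 0" if "Suc i < j \<or> Suc j < i"
    using that by (intro far) auto
  show "\<exists>x. act (E (d - i) * As * E (d - j)) x \<noteq> 0" if "i = Suc j \<or> j = Suc i"
    using that \<open>i \<le> d\<close> \<open>j \<le> d\<close> by (intro near) auto
qed (use w far_s near_s in \<open>auto intro: algebra_module_axioms As.eigenline_system_axioms\<close>)

lemma reverse_Es: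
  assumes "act (Es d) w' = w'" "w' \<noteq> 0"
  shows "leonard_module smul act d A As E (\<lambda>i. Es (d - i)) \<theta> (\<lambda>i. \<theta>s (d - i)) w'"
proof (intro leonard_module.intro leonard_module_axioms.intro)
  show "eigenline_system smul act d As (\<lambda>i. Es (d - i)) (\<lambda>i. \<theta>s (d - i))"
    by (rule As.reverse_eigenline_system)
  fix i j assume "i \<le> d" "j \<le> d"
  then show "Es (d - i) * A * Es (d - j) = 0" if "Suc i < j \<or> Suc j < i"
    using that by (intro far_s) auto
  show "\<exists>x. act (Es (d - i) * A * Es (d - j)) x \<noteq> 0" if "i = Suc j \<or> j = Suc i"
    using that \<open>i \<le> d\<close> \<open>j \<le> d\<close> by (intro near_s) auto
qed (use assms far near in \<open>auto intro: algebra_module_axioms A.eigenline_system_axioms\<close>)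

lemma A_low_s:
  assumes "x \<in> As.low i"
  shows "act A x \<in> As.low (Suc i)"
proof -
  have "act (Es h) (act A x) = 0" if "h \<le> d" "Suc i < h" for h
    unfolding As.act_E_expand[of h A x]
  proof (rule sum.neutral, intro ballI)
    fix j assume "j \<in> {..d}"
    then show "act (Es h * A * Es j) x = 0"
      using that assms far_s[of h j] by (cases "j \<le> i") (auto simp: As.low_def act_mult)
  qed
  then show ?thesis by (simp add: As.low_def)
qed

lemma As_up:
  assumes "x \<in> A.up (Suc i)"
  shows "act As x \<in> A.up i"
proof -
  have "act (E h) (act As x) = 0" if "h \<le> d" "h < i" for h
    unfolding A.act_E_expand[of h As x]
  proof (rule sum.neutral, intro ballI)
    fix j assume "j \<in> {..d}"
    then show "act (E h * As * E j) x = 0"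
      using that assms far[of h j] by (cases "j \<le> i") (auto simp: A.up_def act_mult)
  qed
  then show ?thesis by (simp add: A.up_def)
qed

lemma w_low: "w \<in> As.low i"
proof -
  have "act (Es h) w = 0" if "h \<le> d" "i < h" for h
    using As.act_E_E[of h 0 w] that w(1) by simp
  then show ?thesis by (simp add: As.low_def)
qed

lemma poly_at_w_in_low: "degree p \<le> i \<Longrightarrow> act (poly_at smul p A) w \<in> As.low i"
proof (induction i arbitrary: p)
  case 0
  then obtain c where "p = [:c:]" by (auto elim: degree_eq_zeroE)
  then have "act (poly_at smul p A) w = sc c w" by (simp add: poly_at_def act_smul act_one)
  then show ?case using w_low As.low_sc by simp
next
  case (Suc i)
  obtain c q where p: "p = pCons c q" by (cases p)
  then have "degree q \<le> i" using Suc.prems by (auto split: if_splits)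
  then have "act A (act (poly_at smul q A) w) \<in> As.low (Suc i)"
    by (intro A_low_s Suc.IH)
  then show ?case
    unfolding p A.act_poly_at_pCons by (intro As.low_add As.low_sc w_low)
qed

text \<open>
  Each application of \<open>A\<close> to the \<open>i\<close>th eigenline of \<open>As\<close> has a nonzero component in the next
  eigenline, so polynomials in \<open>A\<close> of degree at most \<open>i\<close> applied to \<open>w\<close> exhaust \<open>[0*]\<^sub>i\<close>.
\<close>

lemma low_s_poly_at:
  "i \<le> d \<Longrightarrow> x \<in> As.low i \<Longrightarrow> \<exists>p. degree p \<le> i \<and> x = act (poly_at smul p A) w"
proof (induction i arbitrary: x)
  case 0
  have "act (Es 0) x = x"
    by (rule As.low_up_line) (use 0 in auto)
  moreover obtain c where "act (Es 0) x = sc c w"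
    using As.line[OF _ w, of x] by auto
  ultimately have "x = act (poly_at smul [:c:] A) w"
    by (simp add: poly_at_def act_smul act_one)
  then show ?case by (intro exI[of _ "[:c:]"]) simp
next
  case (Suc i)
  \<comment> \<open>\<open>b\<close> spans the next eigenline, and subtracting a multiple of \<open>A z\<close> removes its part of \<open>x\<close>.\<close>
  obtain y where y: "act (Es (Suc i) * A * Es i) y \<noteq> 0"
    using near_s[of "Suc i" i] Suc.prems by auto
  define z where "z = act (Es i) y"
  have z: "z \<in> As.low i"
    using Suc.prems As.act_E_E by (auto simp: z_def As.low_def)
  define b where "b = act (Es (Suc i)) (act A z)"
  have b: "b \<noteq> 0" "act (Es (Suc i)) b = b"
    using y Suc.prems by (auto simp: b_def z_def act_mult As.act_E_E)
  obtain c where c: "act (Es (Suc i)) x = sc c b"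
    using As.line[OF Suc.prems(1) b(2,1), of x] by auto
  have "x - sc c (act A z) \<in> As.low i"
  proof -
    have "act (Es h) (x - sc c (act A z)) = 0" if h: "h \<le> d" "i < h" for h
    proof (cases "h = Suc i")
      case True
      then show ?thesis by (simp add: act_diff_right act_sc c b_def)
    next
      case False
      then have "Suc i < h" using h by simp
      then show ?thesis
        using Suc.prems(2) A_low_s[OF z] h by (simp add: As.low_def act_diff_right act_sc)
    qed
    then show ?thesis by (simp add: As.low_def)
  qed
  then obtain p where p: "degree p \<le> i" "x - sc c (act A z) = act (poly_at smul p A) w"
    using Suc.IH[of "x - sc c (act A z)"] Suc.prems by auto
  obtain q where q: "degree q \<le> i" "z = act (poly_at smul q A) w"
    using Suc.IH[OF _ z] Suc.prems by auto
  have "x = act (poly_at smul (p + Polynomial.smult c (pCons 0 q)) A) w"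
    using p(2) unfolding A.act_poly_at_add A.act_poly_at_smult A.act_poly_at_pCons q(2)[symmetric]
    by (simp add: algebra_simps)
  moreover have "degree (p + Polynomial.smult c (pCons 0 q)) \<le> Suc i"
    using p(1) q(1) by (intro degree_add_le order_trans[OF degree_smult_le] order_trans[OF degree_pCons_le]) auto
  ultimately show ?case by blast
qed

definition component :: "nat \<Rightarrow> 'v" where
  "component r = act (E r) w"

lemma component_eigen: "r \<le> d \<Longrightarrow> act (E r) (component r) = component r"
  by (simp add: component_def A.act_E_E)

text \<open>
  The vector \<open>w\<close> is cyclic for \<open>A\<close>: if its component in \<open>E\<^sub>rV\<close> were zero, then \<open>E\<^sub>r\<close> would kill
  all of \<open>V\<close>.
\<close>

lemma component_nonzero:
  assumes "r \<le> d"
  shows "component r \<noteq> 0"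
proof
  assume "component r = 0"
  obtain x where x: "act (E r) x \<noteq> 0" using A.line_nonzero[OF assms] by auto
  obtain p where "x = act (poly_at smul p A) w"
    using low_s_poly_at[of d x] by auto
  then show False
    using x \<open>component r = 0\<close> A.act_E_poly_at[OF assms] by (simp add: component_def)
qed

abbreviation crd :: "nat \<Rightarrow> 'v \<Rightarrow> 'k" where
  "crd r \<equiv> A.coef r (component r)"

lemmas act_E_crd = A.act_E_coef[OF _ component_eigen component_nonzero]
lemmas crd_add = A.coef_add[OF _ component_eigen component_nonzero]
lemmas crd_sc = A.coef_sc[OF _ component_eigen component_nonzero]
lemmas crd_sum = A.coef_sum[OF _ component_eigen component_nonzero]

lemma crd_poly_at: "r \<le> d \<Longrightarrow> crd r (act (poly_at smul p A) w) = poly p (\<theta> r)"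
  by (rule A.coef_unique[OF component_nonzero]) (simp_all add: A.act_E_poly_at component_def)

lemma sum_crd: "x = (\<Sum>s\<le>d. sc (crd s x) (component s))"
  using A.sum_E[of x] act_E_crd by simp

lemma vec_eqI_crd: "(\<And>r. r \<le> d \<Longrightarrow> crd r x = crd r y) \<Longrightarrow> x = y"
  by (rule A.vec_eqI) (simp add: act_E_crd)

definition entry :: "nat \<Rightarrow> nat \<Rightarrow> 'k" where
  "entry r s = crd r (act As (component s))"

lemma act_entry: "r \<le> d \<Longrightarrow> act (E r * As * E s) w = sc (entry r s) (component r)"
  unfolding entry_def act_mult component_def[symmetric] by (rule act_E_crd)

lemma entry_far: "r \<le> d \<Longrightarrow> s \<le> d \<Longrightarrow> Suc r < s \<or> Suc s < r \<Longrightarrow> entry r s = 0"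
  using act_entry[of r s] far[of r s] component_nonzero[of r] by simp

lemma entry_near:
  assumes "r \<le> d" "s \<le> d" "r = Suc s \<or> s = Suc r"
  shows "entry r s \<noteq> 0"
proof
  assume entry: "entry r s = 0"
  obtain x where x: "act (E r * As * E s) x \<noteq> 0" using near[OF assms] by blast
  have "act (E r * As * E s) x = sc (crd s x) (act (E r) (act As (component s)))"
    using act_E_crd[of s x] assms by (simp add: act_mult act_sc)
  also have "act (E r) (act As (component s)) = sc (entry r s) (component r)"
    using act_E_crd[of r "act As (component s)"] assms by (simp add: entry_def)
  finally show False using x entry by simp
qed

lemma crd_As:
  assumes "r \<le> d"
  shows "crd r (act As x) = (\<Sum>s\<le>d. entry r s * crd s x)"
proof -
  have "act As x = (\<Sum>s\<le>d. sc (crd s x) (act As (component s)))"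
    by (subst sum_crd[of x]) (simp add: act_sum_right act_sc)
  then show ?thesis
    using assms by (simp add: crd_sum crd_sc entry_def mult.commute)
qed

definition split_vec :: "nat \<Rightarrow> 'v" where
  "split_vec i = act (poly_at smul (tau \<theta> i) A) w"

lemma crd_split_vec: "r \<le> d \<Longrightarrow> crd r (split_vec i) = (\<Prod>h<i. \<theta> r - \<theta> h)"
  by (simp add: split_vec_def crd_poly_at poly_tau)

lemma split_vec_low: "split_vec i \<in> As.low i"
  unfolding split_vec_def by (rule poly_at_w_in_low) (simp add: monic_tau)

lemma split_vec_up: "split_vec i \<in> A.up i"
proof -
  have "act (E h) (split_vec i) = 0" if h: "h \<le> d" "h < i" for h
  proof -
    have "crd h (split_vec i) = 0"
      unfolding crd_split_vec[OF h(1)] using h by (intro prod_zero bexI[of _ h]) auto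
    then show ?thesis using act_E_crd[of h "split_vec i"] h by simp
  qed
  then show ?thesis by (simp add: A.up_def)
qed

lemma tau_root_nonzero:
  assumes "i \<le> d"
  shows "(\<Prod>h<i. \<theta> i - \<theta> h) \<noteq> 0"
proof -
  have "\<theta> i \<noteq> \<theta> h" if "h < i" for h using A.inj[of i h] that assms by auto
  then show ?thesis by simp
qed

lemma eta_root_nonzero:
  assumes "i \<le> d"
  shows "(\<Prod>h<d - i. \<theta> i - \<theta> (d - h)) \<noteq> 0"
proof -
  have "\<theta> i \<noteq> \<theta> (d - h)" if "h < d - i" for h using A.inj[of i "d - h"] that assms by auto
  then show ?thesis by simp
qed

text \<open>
  The line \<open>[0*D]\<^sub>i\<close>. A vector of \<open>[0*]\<^sub>i\<close> is \<open>p(A) w\<close> with \<open>degree p \<le> i\<close>; it lies in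
  \<open>[D]\<^bsub>d-i\<^esub>\<close> exactly when \<open>p\<close> vanishes at \<open>\<theta> 0, \<dots>, \<theta> (i - 1)\<close>, that is, when \<open>p\<close> is a
  multiple of \<open>tau \<theta> i\<close>.
\<close>

lemma split_line:
  assumes "i \<le> d"
  shows "As.low i \<inter> A.up i = range (\<lambda>c. sc c (split_vec i))"
proof (intro equalityI subsetI)
  fix x assume x: "x \<in> As.low i \<inter> A.up i"
  then obtain p where p: "degree p \<le> i" "x = act (poly_at smul p A) w"
    using low_s_poly_at[OF assms] by blast
  define q where "q = p - Polynomial.smult (coeff p i) (tau \<theta> i)"
  have "q = 0"
  proof (rule ccontr)
    assume q: "q \<noteq> 0"
    have root: "poly q (\<theta> h) = 0" if h: "h < i" for h
    proof -
      have "crd h x = 0"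
        using x h assms component_nonzero[of h] by (intro A.coef_unique) (auto simp: A.up_def)
      then have "poly p (\<theta> h) = 0" using p(2) crd_poly_at[of h p] h assms by simp
      moreover have "poly (tau \<theta> i) (\<theta> h) = 0"
        using h by (auto simp: poly_tau prod_zero_iff)
      ultimately show ?thesis by (simp add: q_def)
    qed
    have "card (\<theta> ` {..<i}) = i"
      using A.inj assms by (subst card_image) (auto simp: inj_on_def)
    moreover have "\<theta> ` {..<i} \<subseteq> {t. poly q t = 0}" using root by auto
    ultimately have "i \<le> card {t. poly q t = 0}"
      using card_mono[OF poly_roots_finite[OF q]] by metis
    also have "\<dots> \<le> degree q" using q by (rule poly_roots_degree)
    finally have "i \<le> degree q" .
    moreover have "degree q \<le> i"
      unfolding q_def using p(1) monic_tau(1)[of \<theta> i]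
      by (intro degree_diff_le order_trans[OF degree_smult_le]) auto
    moreover have "coeff q i = 0"
      using monic_tau[of \<theta> i] by (simp add: q_def)
    ultimately show False using q leading_coeff_0_iff[of q] by simp
  qed
  then have "p = Polynomial.smult (coeff p i) (tau \<theta> i)" by (simp add: q_def)
  then have "x = sc (coeff p i) (split_vec i)"
    using p(2) A.act_poly_at_smult unfolding split_vec_def by metis
  then show "x \<in> range (\<lambda>c. sc c (split_vec i))" by blast
next
  fix x assume "x \<in> range (\<lambda>c. sc c (split_vec i))"
  then obtain c where c: "x = sc c (split_vec i)" by blast
  show "x \<in> As.low i \<inter> A.up i"
    unfolding c by (simp add: As.low_sc A.up_sc split_vec_low split_vec_up)
qed

end

section \<open>The split sequences\<close>

context leonard_module
begin

abbreviation first_coord :: "'v \<Rightarrow> 'k" where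
  "first_coord \<equiv> As.coef 0 w"

text \<open>
  The first split sequence of the Leonard system, with \<open>tr (x E*\<^sub>0)\<close> written as the coordinate
  of \<open>x w\<close> along \<open>w\<close>.
\<close>

definition phi :: "nat \<Rightarrow> 'k" where
  "phi i = (\<theta>s 0 - \<theta>s i) * (first_coord (split_vec i) / first_coord (split_vec (i - 1)))"

lemma split_vec_0: "split_vec 0 = w"
  by (rule A.vec_eqI) (simp add: split_vec_def A.act_E_poly_at poly_tau)

text \<open>
  The element \<open>As - \<theta>s (i + 1)\<close> kills the top part of \<open>[0*]\<^bsub>i+1\<^esub>\<close> and moves the flag \<open>[D]\<close> by at most
  one step, so it sends \<open>split_vec (i + 1)\<close> to a multiple \<open>c\<close> of \<open>split_vec i\<close>. Comparing the
  components at \<open>Es 0\<close> and at \<open>E i\<close> expresses \<open>c\<close> once by traces and once by an entry of \<open>As\<close>.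
\<close>

lemma split_step:
  assumes i: "Suc i \<le> d"
  shows "\<exists>c. (\<theta>s 0 - \<theta>s (Suc i)) * first_coord (split_vec (Suc i)) = c * first_coord (split_vec i) \<and>
    entry i (Suc i) * (\<Prod>h<Suc i. \<theta> (Suc i) - \<theta> h) = c * (\<Prod>h<i. \<theta> i - \<theta> h)"
proof -
  let ?y = "act As (split_vec (Suc i)) - sc (\<theta>s (Suc i)) (split_vec (Suc i))"
  have mem: "split_vec (Suc i) \<in> As.low (Suc i)" "split_vec (Suc i) \<in> A.up (Suc i)"
    by (rule split_vec_low split_vec_up)+
  have "act (Es h) ?y = 0" if h: "h \<le> d" "i < h" for h
    using mem(1) h by (cases "h = Suc i") (auto simp: As.low_def act_diff_right As.act_E_A act_sc)
  then have "?y \<in> As.low i" by (simp add: As.low_def)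
  moreover have "?y \<in> A.up i"
    using As_up[OF mem(2)] A.up_antimono[of i "Suc i"] mem(2) by (intro A.up_diff A.up_sc) auto
  ultimately obtain c where "?y = sc c (split_vec i)"
    using split_line[of i] i by auto
  then have c: "act As (split_vec (Suc i)) = sc c (split_vec i) + sc (\<theta>s (Suc i)) (split_vec (Suc i))"
    by (simp add: diff_eq_eq)
  have "\<theta>s 0 * first_coord (split_vec (Suc i)) = c * first_coord (split_vec i) + \<theta>s (Suc i) * first_coord (split_vec (Suc i))"
    using arg_cong[OF c, of first_coord] by (simp add: As.coef_A As.coef_add As.coef_sc w)
  moreover have "entry i (Suc i) * (\<Prod>h<Suc i. \<theta> (Suc i) - \<theta> h) = c * (\<Prod>h<i. \<theta> i - \<theta> h)"
  proof -
    have only: "entry i s * crd s (split_vec (Suc i)) = (if s = Suc i then entry i s * crd s (split_vec s) else 0)" if "s \<le> d" for s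
    proof (cases "s \<le> i")
      case True
      then have "crd s (split_vec (Suc i)) = 0"
        unfolding crd_split_vec[OF that] by (intro prod_zero bexI[of _ s]) auto
      then show ?thesis using True by simp
    next
      case False
      then show ?thesis using entry_far[of i s] that i by (cases "s = Suc i") auto
    qed
    have "crd i (act As (split_vec (Suc i))) = (\<Sum>s\<le>d. entry i s * crd s (split_vec (Suc i)))"
      using i by (intro crd_As) simp
    also have "\<dots> = (\<Sum>s\<le>d. if s = Suc i then entry i s * crd s (split_vec s) else 0)"
      by (intro sum.cong refl) (rule only, simp)
    also have "\<dots> = entry i (Suc i) * (\<Prod>h<Suc i. \<theta> (Suc i) - \<theta> h)"
      using i by (simp add: crd_split_vec)
    finally show ?thesis
      unfolding c using i by (simp add: crd_add crd_sc crd_split_vec)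
  qed
  ultimately show ?thesis by (intro exI[of _ c]) (auto simp: algebra_simps)
qed

text \<open>
  The denominators of the split sequence: by \<open>split_step\<close>, each is the preceding one times a
  nonzero scalar, because the superdiagonal entries of \<open>As\<close> are nonzero.
\<close>

lemma first_coord_split_vec_nonzero: "i \<le> d \<Longrightarrow> first_coord (split_vec i) \<noteq> 0"
proof (induction i)
  case 0
  then show ?case by (simp add: split_vec_0 As.coef_base w)
next
  case (Suc i)
  obtain c where c: "(\<theta>s 0 - \<theta>s (Suc i)) * first_coord (split_vec (Suc i)) = c * first_coord (split_vec i)"
    "entry i (Suc i) * (\<Prod>h<Suc i. \<theta> (Suc i) - \<theta> h) = c * (\<Prod>h<i. \<theta> i - \<theta> h)"
    using split_step[OF Suc.prems] by blast
  have "c \<noteq> 0"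
    using c(2) entry_near[of i "Suc i"] tau_root_nonzero[OF Suc.prems] Suc.prems by auto
  then show ?case using c(1) Suc by auto
qed

lemma phi_entry:
  assumes i: "Suc i \<le> d"
  shows "entry i (Suc i) * (\<Prod>h<Suc i. \<theta> (Suc i) - \<theta> h) = phi (Suc i) * (\<Prod>h<i. \<theta> i - \<theta> h)"
proof -
  obtain c where c: "(\<theta>s 0 - \<theta>s (Suc i)) * first_coord (split_vec (Suc i)) = c * first_coord (split_vec i)"
    "entry i (Suc i) * (\<Prod>h<Suc i. \<theta> (Suc i) - \<theta> h) = c * (\<Prod>h<i. \<theta> i - \<theta> h)"
    using split_step[OF i] by blast
  have "phi (Suc i) = c"
    using c(1) first_coord_split_vec_nonzero[of i] i by (simp add: phi_def field_simps)
  then show ?thesis using c(2) by simp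
qed

lemma phi_nonzero:
  assumes i: "Suc i \<le> d"
  shows "phi (Suc i) \<noteq> 0"
  using phi_entry[OF i] entry_near[of i "Suc i"] tau_root_nonzero[OF i] i by auto

text \<open>
  The primed notions belong to the polynomials \<open>\<eta>\<^sub>i\<close> and the second split sequence. They are the
  unprimed ones for the reversed order of the \<open>E\<^sub>i\<close>.
\<close>

definition split_vec' :: "nat \<Rightarrow> 'v" where
  "split_vec' i = act (poly_at smul (eta d \<theta> i) A) w"

definition phi' :: "nat \<Rightarrow> 'k" where
  "phi' i = (\<theta>s 0 - \<theta>s i) * (first_coord (split_vec' i) / first_coord (split_vec' (i - 1)))"

lemma reverse_split_vec: "leonard_module.split_vec smul act A (\<lambda>i. \<theta> (d - i)) w = split_vec'"
proof -
  interpret rev: leonard_module smul act d A As "\<lambda>i. E (d - i)" Es "\<lambda>i. \<theta> (d - i)" \<theta>s w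
    by (rule reverse_E)
  show ?thesis by (simp add: fun_eq_iff rev.split_vec_def split_vec'_def eta_eq_tau)
qed

lemma split_vec'_low: "i \<le> d \<Longrightarrow> split_vec' i \<in> A.low (d - i)"
  and split_vec'_low_s: "split_vec' i \<in> As.low i"
proof -
  interpret rev: leonard_module smul act d A As "\<lambda>i. E (d - i)" Es "\<lambda>i. \<theta> (d - i)" \<theta>s w
    by (rule reverse_E)
  show "i \<le> d \<Longrightarrow> split_vec' i \<in> A.low (d - i)"
    using rev.split_vec_up[of i] A.up_reverse[of i] by (simp add: reverse_split_vec)
  show "split_vec' i \<in> As.low i"
    using rev.split_vec_low[of i] by (simp add: reverse_split_vec)
qed

lemma phi'_entry:
  assumes r: "Suc r \<le> d"
  shows "entry (Suc r) r * (\<Prod>h<d - r. \<theta> r - \<theta> (d - h)) =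
    phi' (d - r) * (\<Prod>h<d - Suc r. \<theta> (Suc r) - \<theta> (d - h))"
proof -
  interpret rev: leonard_module smul act d A As "\<lambda>i. E (d - i)" Es "\<lambda>i. \<theta> (d - i)" \<theta>s w
    by (rule reverse_E)
  have phi: "rev.phi i = phi' i" for i
    by (simp add: rev.phi_def phi'_def reverse_split_vec)
  have entry: "rev.entry a b = entry (d - a) (d - b)" for a b
    by (simp add: rev.entry_def entry_def rev.A.coef_def A.coef_def rev.component_def component_def)
  show ?thesis
    using rev.phi_entry[of "d - Suc r"] r unfolding phi entry by (simp add: Suc_diff_Suc)
qed

text \<open>
  An arbitrary vector spanning \<open>E*\<^sub>dV\<close>; it only serves to normalize the functional \<open>last_coord\<close>.
\<close>

definition wd :: 'v where
  "wd = (SOME x. act (Es d) x = x \<and> x \<noteq> 0)"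

lemma wd: "act (Es d) wd = wd" "wd \<noteq> 0"
proof -
  obtain x where "act (Es d) x \<noteq> 0" using As.line_nonzero[of d] by auto
  then have "\<exists>x. act (Es d) x = x \<and> x \<noteq> 0"
    by (intro exI[of _ "act (Es d) x"]) (simp add: As.act_E_E)
  from someI_ex[OF this] show "act (Es d) wd = wd" "wd \<noteq> 0"
    unfolding wd_def by auto
qed

definition last_coord :: "nat \<Rightarrow> 'k" where
  "last_coord r = As.coef d wd (component r)"

lemma coef_d: "As.coef d wd x = (\<Sum>s\<le>d. crd s x * last_coord s)"
  by (subst sum_crd[of x]) (simp add: As.coef_sum As.coef_sc wd last_coord_def)

text \<open>
  The \<open>Es d\<close>-coordinate of \<open>p(A) w\<close> vanishes whenever \<open>degree p < d\<close>. Choosing for \<open>p\<close> the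
  product of all \<open>\<lambda> - \<theta> h\<close> with \<open>h\<close> different from \<open>r\<close> and \<open>r + 1\<close> relates two neighbouring
  values of \<open>last_coord\<close>: multiplied by \<open>\<Prod>\<^sub>j\<^sub>\<noteq>\<^sub>r (\<theta>\<^sub>r - \<theta>\<^sub>j)\<close>, they are constant.
\<close>

lemma last_coord_step:
  assumes r: "Suc r \<le> d"
  shows "last_coord (Suc r) * ((\<Prod>h<Suc r. \<theta> (Suc r) - \<theta> h) * (\<Prod>h<d - Suc r. \<theta> (Suc r) - \<theta> (d - h)))
    = last_coord r * ((\<Prod>h<r. \<theta> r - \<theta> h) * (\<Prod>h<d - r. \<theta> r - \<theta> (d - h)))"
proof -
  define p where "p = tau \<theta> r * eta d \<theta> (d - Suc r)"
  have p: "poly p t = (\<Prod>h<r. t - \<theta> h) * (\<Prod>h<d - Suc r. t - \<theta> (d - h))" for t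
    by (simp add: p_def poly_tau poly_eta)
  have "degree p \<le> d - 1"
    unfolding p_def using degree_mult_le[of "tau \<theta> r" "eta d \<theta> (d - Suc r)"] r
    by (simp add: eta_eq_tau monic_tau)
  then have "act (poly_at smul p A) w \<in> As.low (d - 1)"
    by (rule poly_at_w_in_low)
  then have "act (Es d) (act (poly_at smul p A) w) = 0"
    using r by (auto simp: As.low_def)
  then have "As.coef d wd (act (poly_at smul p A) w) = 0"
    by (intro As.coef_unique wd) simp
  then have "0 = (\<Sum>s\<le>d. poly p (\<theta> s) * last_coord s)"
    by (simp add: coef_d crd_poly_at)
  also have "\<dots> = (\<Sum>s\<in>{r, Suc r}. poly p (\<theta> s) * last_coord s)"
  proof (rule sum.mono_neutral_right)
    show "\<forall>s\<in>{..d} - {r, Suc r}. poly p (\<theta> s) * last_coord s = 0"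
    proof
      fix s assume s: "s \<in> {..d} - {r, Suc r}"
      then consider "s < r" | "d - s < d - Suc r" "s = d - (d - s)" by force
      then have "poly p (\<theta> s) = 0"
      proof cases
        case 1
        then have "(\<Prod>h<r. \<theta> s - \<theta> h) = 0" by (intro prod_zero bexI[of _ s]) auto
        then show ?thesis by (simp add: p)
      next
        case 2
        then have "(\<Prod>h<d - Suc r. \<theta> s - \<theta> (d - h)) = 0"
          by (intro prod_zero bexI[of _ "d - s"]) auto
        then show ?thesis by (simp add: p)
      qed
      then show "poly p (\<theta> s) * last_coord s = 0" by simp
    qed
  qed (use r in auto)
  also have "\<dots> = poly p (\<theta> r) * last_coord r + poly p (\<theta> (Suc r)) * last_coord (Suc r)" by simp
  finally have zero: "poly p (\<theta> r) * last_coord r + poly p (\<theta> (Suc r)) * last_coord (Suc r) = 0" by simp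
  have e: "(\<Prod>h<d - r. t - \<theta> (d - h)) = (\<Prod>h<d - Suc r. t - \<theta> (d - h)) * (t - \<theta> (Suc r))" for t
  proof -
    have "d - r = Suc (d - Suc r)" "d - (d - Suc r) = Suc r" using r by auto
    then show ?thesis by simp
  qed
  have "last_coord (Suc r) * ((\<Prod>h<Suc r. \<theta> (Suc r) - \<theta> h) * (\<Prod>h<d - Suc r. \<theta> (Suc r) - \<theta> (d - h)))
      = poly p (\<theta> (Suc r)) * last_coord (Suc r) * (\<theta> (Suc r) - \<theta> r)"
    by (simp add: p)
  also have "\<dots> = - (poly p (\<theta> r) * last_coord r) * (\<theta> (Suc r) - \<theta> r)"
    using zero by (metis add.inverse_unique)
  also have "\<dots> = last_coord r * ((\<Prod>h<r. \<theta> r - \<theta> h) * (\<Prod>h<d - r. \<theta> r - \<theta> (d - h)))"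
    unfolding p e by (simp add: algebra_simps)
  finally show ?thesis .
qed

lemma last_coord_nonzero:
  assumes "r \<le> d"
  shows "last_coord r \<noteq> 0"
proof
  assume "last_coord r = 0"
  let ?q = "\<lambda>r. (\<Prod>h<r. \<theta> r - \<theta> h) * (\<Prod>h<d - r. \<theta> r - \<theta> (d - h))"
  have q: "?q s \<noteq> 0" if "s \<le> d" for s
    using tau_root_nonzero[OF that] eta_root_nonzero[OF that] by simp
  have const: "last_coord s * ?q s = last_coord 0 * ?q 0" if "s \<le> d" for s
    using that by (induction s) (use last_coord_step in auto)
  have "last_coord 0 * ?q 0 = 0" using const[OF assms] \<open>last_coord r = 0\<close> by (simp only: mult_zero_left)
  then have "last_coord s * ?q s = 0" if "s \<le> d" for s using const[OF that] by (simp only:)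
  then have "last_coord s = 0" if "s \<le> d" for s using q[OF that] that mult_eq_0_iff by blast
  then have "As.coef d wd wd = 0" by (simp add: coef_d)
  then show False using As.coef_base[of d wd] wd by simp
qed

end

section \<open>The switching element\<close>

context leonard_module
begin

definition switch_coeff :: "nat \<Rightarrow> 'k" where
  "switch_coeff r = (\<Prod>h<r. phi' (d - h)) / (\<Prod>h=1..r. phi h)"

definition switching :: 'a where
  "switching = (\<Sum>r\<le>d. smul (switch_coeff r) (E r))"

lemma switch_coeff_step: "Suc r \<le> d \<Longrightarrow> switch_coeff (Suc r) * phi (Suc r) = switch_coeff r * phi' (d - r)"
  using phi_nonzero[of r] by (simp add: switch_coeff_def)

text \<open>
  For neighbouring indices, \<open>phi_entry\<close> and \<open>phi'_entry\<close> express the ratio of the two entries by the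
  ratio of the split parameters, which is that of neighbouring coefficients of \<open>S\<close>; the
  remaining values of \<open>\<tau>\<close> and \<open>\<eta>\<close> are exactly those in \<open>last_coord_step\<close>.
\<close>

lemma entry_symmetrize:
  assumes "r \<le> d" "s \<le> d"
  shows "switch_coeff s * entry r s * last_coord r = switch_coeff r * entry s r * last_coord s"
proof -
  have step: "switch_coeff (Suc r) * entry r (Suc r) * last_coord r = switch_coeff r * entry (Suc r) r * last_coord (Suc r)" if r: "Suc r \<le> d" for r
  proof -
    let ?\<tau> = "\<lambda>i. \<Prod>h<i. \<theta> i - \<theta> h" and ?\<eta> = "\<lambda>i. \<Prod>h<d - i. \<theta> i - \<theta> (d - h)"
    have "switch_coeff (Suc r) * entry r (Suc r) * last_coord r * (?\<tau> r * ?\<eta> r)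
        = switch_coeff (Suc r) * entry r (Suc r) * (last_coord r * (?\<tau> r * ?\<eta> r))"
      by (simp only: mult.assoc)
    also have "\<dots> = switch_coeff (Suc r) * (entry r (Suc r) * ?\<tau> (Suc r)) * (last_coord (Suc r) * ?\<eta> (Suc r))"
      unfolding last_coord_step[OF r, symmetric] by (simp only: ac_simps)
    also have "\<dots> = (switch_coeff (Suc r) * phi (Suc r)) * ?\<tau> r * (last_coord (Suc r) * ?\<eta> (Suc r))"
      unfolding phi_entry[OF r] by (simp only: ac_simps)
    also have "\<dots> = switch_coeff r * (phi' (d - r) * ?\<eta> (Suc r)) * (last_coord (Suc r) * ?\<tau> r)"
      unfolding switch_coeff_step[OF r] by (simp only: ac_simps)
    also have "\<dots> = switch_coeff r * entry (Suc r) r * last_coord (Suc r) * (?\<tau> r * ?\<eta> r)"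
      unfolding phi'_entry[OF r, symmetric] by (simp only: ac_simps)
    finally show ?thesis
      using tau_root_nonzero[of r] eta_root_nonzero[of r] r by simp
  qed
  consider "s = r" | "s = Suc r" | "r = Suc s" | "Suc r < s \<or> Suc s < r" by linarith
  then show ?thesis
  proof cases
    case 2
    then show ?thesis using step[of r] assms by simp
  next
    case 3
    then show ?thesis using step[of s] assms by simp
  next
    case 4
    then show ?thesis using entry_far[of r s] entry_far[of s r] assms by auto
  qed simp
qed

lemma act_E_switching: "r \<le> d \<Longrightarrow> act (E r) (act switching x) = sc (switch_coeff r) (act (E r) x)"
  unfolding switching_def act_sum_left act_smul by (rule A.act_E_sum)

text \<open>
  The values of \<open>last_coord\<close> form a left eigenvector of the matrix of \<open>As\<close> for \<open>\<theta>s d\<close>. Multiplied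
  by \<open>last_coord r\<close>, the \<open>r\<close>th component of \<open>As S w\<close> is turned by \<open>entry_symmetrize\<close> into
  \<open>switch_coeff r\<close> times the \<open>r\<close>th entry of that left eigenvector equation.
\<close>

lemma switching_w_eigen: "act As (act switching w) = sc (\<theta>s d) (act switching w)"
proof (rule vec_eqI_crd)
  fix r assume r: "r \<le> d"
  have crd_switching: "crd s (act switching w) = switch_coeff s" if "s \<le> d" for s
    using that act_E_switching[OF that, of w] component_nonzero by (intro A.coef_unique) (auto simp: component_def)
  have "last_coord r * crd r (act As (act switching w)) = (\<Sum>s\<le>d. switch_coeff s * entry r s * last_coord r)"
    using r by (simp add: crd_As crd_switching sum_distrib_left ac_simps)
  also have "\<dots> = (\<Sum>s\<le>d. switch_coeff r * entry s r * last_coord s)"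
    using entry_symmetrize r by (intro sum.cong) auto
  also have "\<dots> = switch_coeff r * As.coef d wd (act As (component r))"
    by (simp add: coef_d entry_def sum_distrib_left ac_simps)
  also have "\<dots> = last_coord r * crd r (sc (\<theta>s d) (act switching w))"
    using r by (simp add: As.coef_A wd last_coord_def[symmetric] crd_sc crd_switching)
  finally show "crd r (act As (act switching w)) = crd r (sc (\<theta>s d) (act switching w))"
    using last_coord_nonzero[OF r] by simp
qed

lemma switching_w: "act (Es d) (act switching w) = act switching w" "act switching w \<noteq> 0"
proof -
  show "act (Es d) (act switching w) = act switching w"
    by (rule As.eigenvector_E[OF _ switching_w_eigen]) simp
  have "act (E 0) (act switching w) = component 0"
    using act_E_switching[of 0 w] by (simp add: switch_coeff_def component_def)
  then show "act switching w \<noteq> 0" using component_nonzero[of 0] by auto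
qed

lemma switching_commute: "act switching (act (poly_at smul p A) x) = act (poly_at smul p A) (act switching x)"
  by (rule A.vec_eqI) (simp add: act_E_switching A.act_E_poly_at ac_simps)

text \<open>
  An element commuting with \<open>A\<close> sends the split vector \<open>split_vec i\<close> obtained from \<open>w\<close> to the one
  obtained from the image of \<open>w\<close>; if that image spans the eigenline of \<open>Es d\<close>, the latter
  spans \<open>[D*D]\<^sub>i\<close>.
\<close>

lemma image_split_line:
  assumes i: "i \<le> d"
    and commute: "\<And>p x. act Z (act (poly_at smul p A) x) = act (poly_at smul p A) (act Z x)"
    and Zw: "act (Es d) (act Z w) = act Z w" "act Z w \<noteq> 0"
  shows "act Z ` (As.low i \<inter> A.up i) = As.up (d - i) \<inter> A.up i"
proof -
  interpret rev: leonard_module smul act d A As E "\<lambda>i. Es (d - i)" \<theta> "\<lambda>i. \<theta>s (d - i)" "act Z w"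
    by (rule reverse_Es[OF Zw])
  have "As.up (d - i) \<inter> A.up i = range (\<lambda>c. sc c (rev.split_vec i))"
    using rev.split_line[OF i] As.low_reverse[OF i] by simp
  moreover have "rev.split_vec i = act Z (split_vec i)"
    by (simp add: rev.split_vec_def split_vec_def commute)
  ultimately show ?thesis
    unfolding split_line[OF i] by (simp add: image_image act_sc)
qed

text \<open>
  The vectors \<open>split_vec i, \<dots>, split_vec d\<close> span \<open>up i\<close> triangularly, hence the induction from
  the top: modulo \<open>split_vec i\<close>, every vector of \<open>up i\<close> lies in \<open>up (i + 1)\<close>.
\<close>

lemma up_preserved:
  assumes X: "\<And>i. i \<le> d \<Longrightarrow> act X (split_vec i) \<in> A.up i"
  shows "i \<le> Suc d \<Longrightarrow> x \<in> A.up i \<Longrightarrow> act X x \<in> A.up i"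
proof (induction i arbitrary: x rule: inc_induct)
  case base
  have "x = 0" by (rule A.vec_eqI) (use base in \<open>simp add: A.up_def\<close>)
  then show ?case by (simp add: A.up_def)
next
  case (step i)
  then have i: "i \<le> d" by simp
  define k where "k = crd i x / crd i (split_vec i)"
  have mem: "split_vec i \<in> A.up i" "crd i (split_vec i) \<noteq> 0"
    by (rule split_vec_up) (simp only: crd_split_vec[OF i] tau_root_nonzero[OF i] not_False_eq_True)
  have "x - sc k (split_vec i) \<in> A.up (Suc i)"
  proof -
    have "act (E h) (x - sc k (split_vec i)) = 0" if "h \<le> d" "h < Suc i" for h
    proof (cases "h = i")
      case True
      then show ?thesis
        using mem(2) act_E_crd[of i x] act_E_crd[of i "split_vec i"] i
        by (simp add: act_diff_right act_sc k_def)
    next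
      case False
      then show ?thesis
        using that mem(1) step.prems by (simp add: act_diff_right act_sc A.up_def)
    qed
    then show ?thesis by (simp add: A.up_def)
  qed
  then have "act X (x - sc k (split_vec i)) \<in> A.up i"
    using step.IH A.up_antimono[of i "Suc i"] by auto
  then have "act X (x - sc k (split_vec i)) + sc k (act X (split_vec i)) \<in> A.up i"
    using X[OF i] by (intro A.up_add A.up_sc)
  then show ?case by (simp add: act_diff_right act_sc)
qed

lemma low_preserved:
  assumes X: "\<And>i. i \<le> d \<Longrightarrow> act X (split_vec' i) \<in> A.low (d - i)"
    and i: "i \<le> d" and x: "x \<in> A.low i"
  shows "act X x \<in> A.low i"
proof -
  interpret rev: leonard_module smul act d A As "\<lambda>i. E (d - i)" Es "\<lambda>i. \<theta> (d - i)" \<theta>s w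
    by (rule reverse_E)
  have "act X x \<in> rev.A.up (d - i)"
  proof (rule rev.up_preserved)
    show "act X (rev.split_vec j) \<in> rev.A.up j" if "j \<le> d" for j
      using X[OF that] A.up_reverse[OF that] by (simp add: reverse_split_vec)
    show "x \<in> rev.A.up (d - i)"
      using x i A.up_reverse[of "d - i"] by simp
  qed simp
  then show ?thesis using i A.up_reverse[of "d - i"] by simp
qed

text \<open>
  Preserving both flags of \<open>A\<close> forces \<open>X\<close> to preserve every eigenline of \<open>A\<close>, so \<open>X\<close> is
  determined by its value at \<open>w\<close>, which has a component in each of them.
\<close>

lemma eq_multiple_switching:
  assumes up: "\<And>i. i \<le> d \<Longrightarrow> act X (split_vec i) \<in> A.up i"
    and low: "\<And>i. i \<le> d \<Longrightarrow> act X (split_vec' i) \<in> A.low (d - i)"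
    and Xw: "act (Es d) (act X w) = act X w"
  shows "\<exists>k. \<forall>x. act X x = sc k (act switching x)"
proof -
  obtain k where k: "act X w = sc k (act switching w)"
    using As.line[OF _ switching_w, of "act X w"] Xw by auto
  have line: "act (E r) (act X (component r)) = act X (component r)" if r: "r \<le> d" for r
  proof (rule A.low_up_line[OF r])
    have "component r \<in> A.low r" "component r \<in> A.up r"
      using r by (auto simp: A.low_def A.up_def component_def A.act_E_E)
    then show "act X (component r) \<in> A.low r" "act X (component r) \<in> A.up r"
      using low_preserved[OF low r] up_preserved[OF up, of r] r by auto
  qed
  have "act X (component r) = sc k (act switching (component r))" if r: "r \<le> d" for r
  proof -
    have "act (E r) (act X w) = (\<Sum>s\<le>d. if s = r then act X (component r) else 0)"
    proof -
      have "act (E r) (act X (component s)) = (if s = r then act X (component r) else 0)" if "s \<le> d" for s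
        using line[OF r] line[OF that] A.act_E_E[OF r that, of "act X (component s)"] by auto
      then show ?thesis
        by (subst A.sum_E[of w]) (simp add: act_sum_right component_def)
    qed
    then have "act X (component r) = act (E r) (act X w)" using r by simp
    also have "\<dots> = sc k (sc (switch_coeff r) (component r))"
      using r by (simp add: k act_sc act_E_switching component_def)
    also have "sc (switch_coeff r) (component r) = act switching (component r)"
      by (rule A.vec_eqI) (use r in \<open>simp add: act_E_switching act_sc component_def A.act_E_E\<close>)
    finally show ?thesis .
  qed
  then have "act X x = sc k (act switching x)" for x
    by (subst (1 2) sum_crd[of x]) (simp add: act_sum_right act_sc V.scale_sum_right ac_simps)
  then show ?thesis by blast
qed

lemma decomposition_eq:
  assumes "i \<le> d"
  shows "decomposition d act E Es Flag0s Flag0 i = As.low i \<inter> A.low (d - i)"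
    and "decomposition d act E Es Flag0s FlagD i = As.low i \<inter> A.up i"
    and "decomposition d act E Es FlagDs Flag0 i = As.up (d - i) \<inter> A.low (d - i)"
    and "decomposition d act E Es FlagDs FlagD i = As.up (d - i) \<inter> A.up i"
  using assms A.sum_range_low[of "d - i"] As.sum_range_low[of i] A.sum_range_up[of i]
    As.sum_range_up[of "d - i"]
  by (simp_all add: decomposition_def)

lemma image_decomposition:
  assumes i: "i \<le> d" and X: "X = smul k switching" and k: "k \<noteq> 0"
  shows "act X ` decomposition d act E Es Flag0s FlagD i = decomposition d act E Es FlagDs FlagD i"
    and "act X ` decomposition d act E Es Flag0s Flag0 i = decomposition d act E Es FlagDs Flag0 i"
proof -
  have commute: "act X (act (poly_at smul p A) x) = act (poly_at smul p A) (act X x)" for p x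
    by (simp add: X act_smul act_sc switching_commute)
  have Xw: "act (Es d) (act X w) = act X w" "act X w \<noteq> 0"
    using switching_w k by (simp_all add: X act_smul act_sc)
  interpret rev: leonard_module smul act d A As "\<lambda>i. E (d - i)" Es "\<lambda>i. \<theta> (d - i)" \<theta>s w
    by (rule reverse_E)
  show "act X ` decomposition d act E Es Flag0s FlagD i = decomposition d act E Es FlagDs FlagD i"
    unfolding decomposition_eq[OF i] by (rule image_split_line[OF i commute Xw])
  show "act X ` decomposition d act E Es Flag0s Flag0 i = decomposition d act E Es FlagDs Flag0 i"
    using rev.image_split_line[OF i commute Xw]
    unfolding decomposition_eq[OF i] A.up_reverse[OF i] .
qed

lemma eq_multiple_switching_of_decomposition:
  assumes "\<And>i. i \<le> d \<Longrightarrow>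
      act X ` decomposition d act E Es Flag0s Flag0 i \<subseteq> decomposition d act E Es FlagDs Flag0 i"
    and "\<And>i. i \<le> d \<Longrightarrow>
      act X ` decomposition d act E Es Flag0s FlagD i \<subseteq> decomposition d act E Es FlagDs FlagD i"
  shows "\<exists>k. \<forall>x. act X x = sc k (act switching x)"
proof (rule eq_multiple_switching)
  show "act X (split_vec i) \<in> A.up i" if "i \<le> d" for i
    using assms(2)[OF that] split_vec_low split_vec_up unfolding decomposition_eq[OF that] by blast
  show "act X (split_vec' i) \<in> A.low (d - i)" if "i \<le> d" for i
    using assms(1)[OF that] split_vec'_low[OF that] split_vec'_low_s unfolding decomposition_eq[OF that] by blast
  have "act X w \<in> As.up d"
    using assms(2)[of 0] split_vec_low[of 0] split_vec_up[of 0] decomposition_eq[of 0] by (auto simp: split_vec_0)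
  then show "act (Es d) (act X w) = act X w"
    by (intro As.low_up_line) auto
qed

end

section \<open>The simple module of a full matrix algebra\<close>

context full_matrix_algebra
begin

lemma iso_sum: "finite I \<Longrightarrow> f (sum h I) = Matrix.mat (d + 1) (d + 1) (\<lambda>(r, s). \<Sum>i\<in>I. f (h i) $$ (r, s))"
  by (induction I rule: finite_induct) (auto simp: iso_zero iso_add intro!: eq_matI)

text \<open>
  Left and right multiplication by matrix units moves a nonzero entry of \<open>X\<close> to any place,
  so if \<open>X\<close> annihilates \<open>V\<close>, then all diagonal matrix units do, and with them the identity.
\<close>

lemma act_faithful:
  fixes act :: "'a \<Rightarrow> 'v::ab_group_add \<Rightarrow> 'v" and v0 :: 'v
  assumes mod: "left_module act" and nz: "v0 \<noteq> 0"
    and kill: "\<And>v. act X v = 0"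
  shows "X = 0"
proof (rule ccontr)
  interpret left_module act by (rule mod)
  interpret algebra_module smul act ..
  assume "X \<noteq> 0"
  then have nonzero: "f X \<noteq> 0\<^sub>m (d + 1) (d + 1)" using iso_inject[of X 0] iso_zero by auto
  have "\<exists>p<d + 1. \<exists>q<d + 1. f X $$ (p, q) \<noteq> 0"
  proof (rule ccontr)
    assume "\<not> ?thesis"
    then have "f X = 0\<^sub>m (d + 1) (d + 1)" by (intro eq_matI) auto
    with nonzero show False by simp
  qed
  then obtain p q where pq: "p < d + 1" "q < d + 1" "f X $$ (p, q) \<noteq> 0"
    by blast
  have "\<exists>e. \<forall>r s. f (e r s) = Matrix.mat (d + 1) (d + 1) (\<lambda>(i, j). if i = r \<and> j = s then 1 else 0)"
  proof -
    have "\<exists>x. f x = Matrix.mat (d + 1) (d + 1) (\<lambda>(i, j). if i = r \<and> j = s then 1 else 0)" for r s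
      using bij_betw_imp_surj_on[OF iso_bij] by (metis (no_types, lifting) imageE mat_carrier)
    then show ?thesis by metis
  qed
  then obtain e where e: "\<And>r s. f (e r s) = Matrix.mat (d + 1) (d + 1) (\<lambda>(i, j). if i = r \<and> j = s then 1 else 0)"
    by blast
  have entry: "e r p * X * e q r = smul (f X $$ (p, q)) (e r r)" if r: "r < d + 1" for r
  proof (rule iso_inject, rule eq_matI)
    fix i j assume "i < dim_row (f (smul (f X $$ (p, q)) (e r r)))" "j < dim_col (f (smul (f X $$ (p, q)) (e r r)))"
    then have ij: "i < d + 1" "j < d + 1" by auto
    have left: "(f (e r p) * f X) $$ (i, k) = (if i = r then f X $$ (p, k) else 0)" if k: "k < d + 1" for k
    proof -
      have "(f (e r p) * f X) $$ (i, k) = (\<Sum>l<d + 1. (if i = r \<and> l = p then 1 else 0) * f X $$ (l, k))"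
        using ij k by (simp add: scalar_prod_def e lessThan_atLeast0)
      also have "\<dots> = (\<Sum>l<d + 1. if l = p then (if i = r then f X $$ (p, k) else 0) else 0)"
        by (intro sum.cong) auto
      finally show ?thesis using pq by (simp add: sum.delta del: sum.lessThan_Suc)
    qed
    have "f (e r p * X * e q r) $$ (i, j)
        = (\<Sum>k<d + 1. (f (e r p) * f X) $$ (i, k) * (if k = q \<and> j = r then 1 else 0))"
      using ij by (simp add: iso_mult scalar_prod_def e lessThan_atLeast0)
    also have "\<dots> = (\<Sum>k<d + 1. if k = q then (if i = r \<and> j = r then f X $$ (p, q) else 0) else 0)"
      by (intro sum.cong refl) (use left in auto)
    also have "\<dots> = f (smul (f X $$ (p, q)) (e r r)) $$ (i, j)"
      using pq ij by (simp add: sum.delta iso_smul e del: sum.lessThan_Suc)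
    finally show "f (e r p * X * e q r) $$ (i, j) = f (smul (f X $$ (p, q)) (e r r)) $$ (i, j)" .
  qed auto
  have "act (e r r) v = 0" if r: "r < d + 1" for r v
  proof -
    have "sc (f X $$ (p, q)) (act (e r r) v) = 0"
      unfolding act_smul[symmetric] entry[OF r, symmetric] by (simp add: act_mult kill)
    then show ?thesis using pq(3) by simp
  qed
  moreover have "(\<Sum>r<d + 1. e r r) = 1"
  proof (rule iso_inject, rule eq_matI)
    fix i j assume "i < dim_row (f 1)" "j < dim_col (f 1)"
    then have ij: "i < d + 1" "j < d + 1" by auto
    have "f (\<Sum>r<d + 1. e r r) $$ (i, j) = (\<Sum>r<d + 1. if r = i then (if i = j then 1 else 0) else 0)"
      using ij by (cases "i = j") (auto simp: iso_sum e simp del: sum.lessThan_Suc intro!: sum.neutral)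
    then show "f (\<Sum>r<d + 1. e r r) $$ (i, j) = f 1 $$ (i, j)"
      using ij by (simp add: iso_one del: sum.lessThan_Suc)
  qed auto
  ultimately have "act 1 v0 = 0"
    using act_sum_left[of "\<lambda>r. e r r" "{..<d + 1}" v0] by simp
  then show False using nz by (simp add: act_one)
qed

text \<open>
  All identities are checked in a basis of eigenvectors of \<open>A\<close>. The fifth one, \<open>E\<^sub>i x E\<^sub>i = tr (x E\<^sub>i) E\<^sub>i\<close>, is what
  makes \<open>E\<^sub>iV\<close> a line and turns the traces in the split sequences into coordinates.
\<close>

lemma primitive_idempotents:
  assumes ord: "associated_orderings smul d f A E \<theta>"
  shows "i \<le> d \<Longrightarrow> j \<le> d \<Longrightarrow> \<theta> i = \<theta> j \<Longrightarrow> i = j"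
    and "i \<le> d \<Longrightarrow> j \<le> d \<Longrightarrow> E i * E j = (if i = j then E i else 0)"
    and "(\<Sum>i\<le>d. E i) = 1"
    and "i \<le> d \<Longrightarrow> A * E i = smul (\<theta> i) (E i)"
    and "i \<le> d \<Longrightarrow> E i * x * E i = smul (alg_trace d f (x * E i)) (E i)"
    and "i \<le> d \<Longrightarrow> E i \<noteq> 0"
proof -
  show "i \<le> d \<Longrightarrow> j \<le> d \<Longrightarrow> \<theta> i = \<theta> j \<Longrightarrow> i = j"
    using ord by (auto simp: associated_orderings_def eigenvalue_ordering_def bij_betw_def dest: inj_onD)
  obtain g where g: "full_matrix_algebra smul d g"
    and tr: "\<And>x. alg_trace d g x = alg_trace d f x"
    and gA: "g A = mat_diag (d + 1) \<theta>"
    and gE: "\<And>i. i \<le> d \<Longrightarrow> g (E i) = mat_diag (d + 1) (\<lambda>k. if k = i then 1 else 0)"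
    using diagonalizing_isomorphism[OF ord] by metis
  interpret g: full_matrix_algebra smul d g by (rule g)
  show "E i * E j = (if i = j then E i else 0)" if "i \<le> d" "j \<le> d"
  proof (rule g.iso_inject)
    have "g (E i * E j) = mat_diag (d + 1) (\<lambda>k. (if k = i then 1 else 0) * (if k = j then 1 else 0))"
      by (simp only: g.iso_mult gE that mat_diag_diag)
    also have "\<dots> = g (if i = j then E i else 0)"
      using that by (auto simp: gE g.iso_zero mat_diag_def intro!: eq_matI)
    finally show "g (E i * E j) = g (if i = j then E i else 0)" .
  qed
  show "(\<Sum>i\<le>d. E i) = 1"
    by (rule g.iso_inject) (auto simp: g.iso_sum g.iso_one gE mat_diag_def sum.delta intro!: eq_matI)
  show "A * E i = smul (\<theta> i) (E i)" if "i \<le> d"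
  proof (rule g.iso_inject)
    have "g (A * E i) = mat_diag (d + 1) (\<lambda>k. \<theta> k * (if k = i then 1 else 0))"
      by (simp only: g.iso_mult gE gA that mat_diag_diag)
    also have "\<dots> = g (smul (\<theta> i) (E i))"
      using that by (auto simp: gE g.iso_smul mat_diag_def intro!: eq_matI)
    finally show "g (A * E i) = g (smul (\<theta> i) (E i))" .
  qed
  show "E i * x * E i = smul (alg_trace d f (x * E i)) (E i)" if i: "i \<le> d"
  proof (rule g.iso_inject)
    note R = mat_diag_mult_right[of _ "d + 1" "d + 1"] and L = mat_diag_mult_left[of _ "d + 1" "d + 1"]
    have "alg_trace d g (x * E i) = (\<Sum>k<d + 1. if k = i then g x $$ (i, i) else 0)"
      unfolding alg_trace_def g.iso_mult gE[OF i] R[OF g.iso_carrier]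
      by (intro sum.cong) auto
    also have "\<dots> = g x $$ (i, i)" using i by (simp add: sum.delta del: sum.lessThan_Suc)
    finally have t: "alg_trace d f (x * E i) = g x $$ (i, i)" unfolding tr .
    have "g (E i * x * E i) = mat_diag (d + 1) (\<lambda>k. if k = i then 1 else 0) * g x
        * mat_diag (d + 1) (\<lambda>k. if k = i then 1 else 0)"
      using i by (simp add: g.iso_mult gE)
    also have "\<dots> = g (smul (alg_trace d f (x * E i)) (E i))"
      unfolding L[OF g.iso_carrier] R[OF mat_carrier] g.iso_smul t gE[OF i]
      by (auto simp: mat_diag_def intro!: eq_matI)
    finally show "g (E i * x * E i) = g (smul (alg_trace d f (x * E i)) (E i))" .
  qed
  show "E i \<noteq> 0" if i: "i \<le> d"
  proof
    assume "E i = 0"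
    then have "g (E i) $$ (i, i) = 0" using i by (simp add: g.iso_zero)
    then show False using i by (simp add: gE mat_diag_def)
  qed
qed

lemma eigenline_systemI:
  fixes act :: "'a \<Rightarrow> 'v::ab_group_add \<Rightarrow> 'v"
  assumes simp: "simple_left_module act"
    and ord: "associated_orderings smul d f A E \<theta>"
  shows "eigenline_system smul act d A E \<theta>"
proof -
  interpret simple_left_module act by (rule simp)
  interpret algebra_module smul act ..
  note E = primitive_idempotents[OF ord]
  obtain v0 :: 'v where v0: "v0 \<noteq> 0" using nonzero by auto
  show ?thesis
  proof
    show "i \<le> d \<Longrightarrow> j \<le> d \<Longrightarrow> \<theta> i = \<theta> j \<Longrightarrow> i = j" for i j by (rule E)
    show "i \<le> d \<Longrightarrow> j \<le> d \<Longrightarrow> E i * E j = (if i = j then E i else 0)" for i j by (rule E)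
    show "(\<Sum>i\<le>d. E i) = 1" by (rule E)
    show "i \<le> d \<Longrightarrow> A * E i = smul (\<theta> i) (E i)" for i by (rule E)
    show "\<exists>v. act (E i) v \<noteq> 0" if "i \<le> d" for i
      using act_faithful[OF left_module_axioms v0, of "E i"] E(6)[OF that] by blast
    fix i v x assume i: "i \<le> d" and v: "act (E i) v = v" "v \<noteq> 0"
    \<comment> \<open>By simplicity \<open>x = a v\<close> for some \<open>a\<close>, and \<open>E i * a * E i\<close> is a multiple of \<open>E i\<close>.\<close>
    let ?W = "range (\<lambda>a. act a v)"
    have "submodule_of act ?W"
      unfolding submodule_of_def
    proof (intro conjI ballI allI)
      show "0 \<in> ?W" by (rule range_eqI[where x = 0]) simp
    qed (auto simp: act_add_left[symmetric] act_mult[symmetric])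
    moreover have "v \<in> ?W" by (rule range_eqI[where x = 1]) (simp add: act_one)
    ultimately have "x \<in> ?W" using simple[of ?W] v(2) by auto
    then obtain a where a: "x = act a v" by auto
    have "act (E i) x = act (E i * a * E i) v" by (simp add: a act_mult v)
    also have "\<dots> = sc (alg_trace d f (a * E i)) v"
      unfolding E(5)[OF i] act_smul v ..
    finally show "\<exists>c. act (E i) x = sc c v" ..
  qed
qed

end

lemma (in full_matrix_algebra) leonard_moduleI:
  fixes act :: "'a \<Rightarrow> 'v::ab_group_add \<Rightarrow> 'v"
  assumes simp: "simple_left_module act"
    and L: "leonard_system smul d f A E As Es"
    and ord: "associated_orderings smul d f A E \<theta>" "associated_orderings smul d f As Es \<theta>s"
  shows "\<exists>w. leonard_module smul act d A As E Es \<theta> \<theta>s w \<and>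
    switching_element smul d f A E \<theta> Es \<theta>s = leonard_module.switching smul act d A E Es \<theta> \<theta>s w"
proof -
  interpret simple_left_module act by (rule simp)
  obtain v0 :: 'v where v0: "v0 \<noteq> 0" using nonzero by auto
  interpret A: eigenline_system smul act d A E \<theta> by (rule eigenline_systemI[OF simp ord(1)])
  interpret As: eigenline_system smul act d As Es \<theta>s by (rule eigenline_systemI[OF simp ord(2)])
  have faithful: "\<exists>x. act X x \<noteq> 0" if "X \<noteq> 0" for X
    using act_faithful[OF left_module_axioms v0] that by blast
  obtain x where x: "act (Es 0) x \<noteq> 0" using As.line_nonzero[of 0] by auto
  define w where "w = act (Es 0) x"
  have w: "act (Es 0) w = w" "w \<noteq> 0" using x by (simp_all add: w_def As.act_E_E)
  have T: "1 < \<bar>int i - int j\<bar> \<Longrightarrow> E i * As * E j = 0 \<and> Es i * A * Es j = 0"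
    "\<bar>int i - int j\<bar> = 1 \<Longrightarrow> E i * As * E j \<noteq> 0 \<and> Es i * A * Es j \<noteq> 0"
    if "i \<le> d" "j \<le> d" for i j
    using L that unfolding leonard_system_def by blast+
  interpret leonard_module smul act d A As E Es \<theta> \<theta>s w
  proof
    fix i j assume ij: "i \<le> d" "j \<le> d"
    show "E i * As * E j = 0" "Es i * A * Es j = 0" if "Suc i < j \<or> Suc j < i"
      using T(1)[OF ij] that by auto
    show "\<exists>x. act (E i * As * E j) x \<noteq> 0" "\<exists>x. act (Es i * A * Es j) x \<noteq> 0"
      if "i = Suc j \<or> j = Suc i"
      using T(2)[OF ij] that by (auto intro!: faithful)
  qed (fact w)+
  have tr: "alg_trace d f (x * Es 0) = first_coord (act x w)" for x
  proof (rule As.coef_unique[symmetric, OF w(2)])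
    have "act (Es 0) (act x w) = act (Es 0 * x * Es 0) w" by (simp add: act_mult w)
    also have "\<dots> = A.sc (alg_trace d f (x * Es 0)) w"
      using primitive_idempotents(5)[OF ord(2), of 0 x] by (simp add: A.act_smul w)
    finally show "act (Es 0) (act x w) = A.sc (alg_trace d f (x * Es 0)) w" .
  qed
  have "first_split smul d f A \<theta> Es \<theta>s = phi" "second_split smul d f A \<theta> Es \<theta>s = phi'"
    by (simp_all add: fun_eq_iff first_split_def second_split_def phi_def phi'_def tr split_vec_def split_vec'_def)
  then have "switching_element smul d f A E \<theta> Es \<theta>s = switching"
    by (simp add: switching_element_def switching_def switch_coeff_def)
  then show ?thesis using leonard_module_axioms by blast
qed

theorem theorem10p1:
  fixes smul :: "'k::field \<Rightarrow> 'a::ring_1 \<Rightarrow> 'a"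
    and d :: nat
    and f :: "'a \<Rightarrow> 'k mat"
    and act :: "'a \<Rightarrow> 'v::ab_group_add \<Rightarrow> 'v"
    and A As X S :: 'a
    and E Es :: "nat \<Rightarrow> 'a"
    and \<theta> \<theta>s :: "nat \<Rightarrow> 'k"
  assumes "full_matrix_algebra smul d f"
    and "simple_left_module act"
    and "leonard_system smul d f A E As Es"
    and "associated_orderings smul d f A E \<theta>"
    and "associated_orderings smul d f As Es \<theta>s"
    and "S = switching_element smul d f A E \<theta> Es \<theta>s"
    and "X \<noteq> 0"
  shows
    "((\<exists>c. X = smul c S) \<longleftrightarrow>
       (seq_subset d (seq_image act X (decomposition d act E Es Flag0s Flag0))
          (decomposition d act E Es FlagDs Flag0) \<and>
        seq_subset d (seq_image act X (decomposition d act E Es Flag0s FlagD))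
          (decomposition d act E Es FlagDs FlagD))) \<and>
     ((\<exists>c. X = smul c S) \<and>
        seq_subset d (seq_image act X (decomposition d act E Es Flag0s Flag0))
          (decomposition d act E Es FlagDs Flag0) \<and>
        seq_subset d (seq_image act X (decomposition d act E Es Flag0s FlagD))
          (decomposition d act E Es FlagDs FlagD)
      \<longrightarrow>
        seq_equal d (seq_image act X (decomposition d act E Es Flag0s Flag0))
          (decomposition d act E Es FlagDs Flag0) \<and>
        seq_equal d (seq_image act X (decomposition d act E Es Flag0s FlagD))
          (decomposition d act E Es FlagDs FlagD))"
proof -
  interpret full_matrix_algebra smul d f by fact
  interpret simple_left_module act by fact
  obtain w where lm: "leonard_module smul act d A As E Es \<theta> \<theta>s w"
    and S: "S = leonard_module.switching smul act d A E Es \<theta> \<theta>s w"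
    using leonard_moduleI[OF assms(2-5)] assms(6) by blast
  interpret lm: leonard_module smul act d A As E Es \<theta> \<theta>s w by (rule lm)
  have image: "act X ` decomposition d act E Es Flag0s FlagD i = decomposition d act E Es FlagDs FlagD i \<and>
      act X ` decomposition d act E Es Flag0s Flag0 i = decomposition d act E Es FlagDs Flag0 i"
    if "X = smul c S" "i \<le> d" for c i
  proof -
    have "c \<noteq> 0" using that(1) \<open>X \<noteq> 0\<close> by auto
    then show ?thesis
      using lm.image_decomposition[OF that(2) that(1)[unfolded S]] by blast
  qed
  moreover have "\<exists>c. X = smul c S"
    if sub: "\<And>i. i \<le> d \<Longrightarrow> act X ` decomposition d act E Es Flag0s Flag0 i \<subseteq> decomposition d act E Es FlagDs Flag0 i"
      "\<And>i. i \<le> d \<Longrightarrow> act X ` decomposition d act E Es Flag0s FlagD i \<subseteq> decomposition d act E Es FlagDs FlagD i"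
  proof -
    obtain k where k: "\<And>x. act X x = lm.sc k (act S x)"
      using lm.eq_multiple_switching_of_decomposition[OF sub] S by blast
    have "X - smul k S = 0"
      by (rule act_faithful[OF left_module_axioms lm.w(2)]) (simp add: lm.act_diff_left lm.act_smul k)
    then show ?thesis by auto
  qed
  ultimately show ?thesis
    unfolding seq_subset_def seq_equal_def seq_image_def by (metis (no_types, lifting) order_refl)
qed

end
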